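(* Let $G$ be a locally compact abelian group with Haar measure $du$, let $X,Y$ be Banach spaces and let $K\in L^1_{\mathcal L(X,Y)}(G)$. Assume that there exist strongly continuous representations $R$ and $\tilde R$ of $G$ such that: (1) for every $u\in G$, $R_u\in\mathcal L(X,X)$ and $\tilde R_u\in\mathcal L(Y,Y)$; (2) there exist constants $c_1$ and $c_2$ such that $\|R_u\|_{\mathcal L(X,X)}\le c_1$ and $\|\tilde R_u\|_{\mathcal L(Y,Y)}\le c_2$ for all $u\in G$; (3) $R$ and $\tilde R$ intertwine $K$, in the sense that $K(u)R_v x=\tilde R_v K(u)x$ for all $u,v\in G$ and $x\in X$. Define $T_K x=\int_G K(u)R_{-u}x\,du$ for $x\in X$. Then $T_K$ is well defined as an element of $\mathcal L(X,Y)$ and $$\|T_K\|\le \inf_{1\le p<\infty} c_1c_2N_{p,X,Y}(K),$$ where $N_{p,X,Y}(K)$ denotes the norm of the convolution operator defined by the kernel $K$ from $L^p_X(G)$ into $L^p_Y(G)$.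
   Context: $\mathcal L(X,Y)$ is the space of bounded linear operators from $X$ to $Y$ with the operator norm. For a Banach space $B$, $L^p_B(G)$ denotes the Lebesgue-Bochner space of $B$-valued $p$-integrable functions on $G$ with respect to Haar measure. The group $G$ is written additively. The convolution operator with kernel $K$ is $f\mapsto K*f$, $K*f(v)=\int_G K(u)f(v-u)\,du$. The integral defining $T_Kx$ is a $Y$-valued Bochner integral. *)

theory Defs
  imports "HOL-Analysis.Analysis"
begin

section \<open>Haar measure\<close>

text \<open>A Haar measure is a nonzero, translation-invariant Radon measure on the Borel sets:
  finite on compact sets, outer regular on Borel sets, inner regular on open sets.
  It need not be sigma-finite.\<close>

definition haar_measure :: "'g::{topological_ab_group_add, t2_space} measure \<Rightarrow> bool" where
  "haar_measure \<mu> \<longleftrightarrow>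
     sets \<mu> = sets borel \<and>
     emeasure \<mu> UNIV \<noteq> 0 \<and>
     (\<forall>a. \<forall>A\<in>sets borel. emeasure \<mu> ((+) a ` A) = emeasure \<mu> A) \<and>
     (\<forall>C. compact C \<longrightarrow> emeasure \<mu> C < \<infinity>) \<and>
     (\<forall>A\<in>sets borel. emeasure \<mu> A = (INF U\<in>{U. open U \<and> A \<subseteq> U}. emeasure \<mu> U)) \<and>
     (\<forall>U. open U \<longrightarrow> emeasure \<mu> U = (SUP C\<in>{C. compact C \<and> C \<subseteq> U}. emeasure \<mu> C))"

section \<open>Bochner integration in arbitrary Banach spaces\<close>

text \<open>The library's \<open>integrable\<close> and \<open>integral\<^sup>L\<close> only apply to second countable value spaces,
  which excludes nonseparable Banach spaces and, typically, the space of bounded operators.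
  The notions below have no separability restriction; only \<open>simple_function\<close>,
  \<open>simple_bochner_integrable\<close> and \<open>simple_bochner_integral\<close> are taken from the library.\<close>

definition strongly_measurable :: "'a measure \<Rightarrow> ('a \<Rightarrow> 'b::real_normed_vector) \<Rightarrow> bool" where
  "strongly_measurable M f \<longleftrightarrow>
     (\<exists>s. (\<forall>n. simple_function M (s n)) \<and> (AE x in M. (\<lambda>n::nat. s n x) \<longlonglongrightarrow> f x))"

definition bochner_has_integral ::
    "'a measure \<Rightarrow> ('a \<Rightarrow> 'b::real_normed_vector) \<Rightarrow> 'b \<Rightarrow> bool" where
  "bochner_has_integral M f I \<longleftrightarrow>
     strongly_measurable M f \<and>
     (\<exists>s. (\<forall>n. Bochner_Integration.simple_bochner_integrable M (s n)) \<and>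
          (\<lambda>n::nat. \<integral>\<^sup>+x. ennreal (norm (f x - s n x)) \<partial>M) \<longlonglongrightarrow> 0 \<and>
          (\<lambda>n. Bochner_Integration.simple_bochner_integral M (s n)) \<longlonglongrightarrow> I)"

definition bochner_integrable :: "'a measure \<Rightarrow> ('a \<Rightarrow> 'b::real_normed_vector) \<Rightarrow> bool" where
  "bochner_integrable M f \<longleftrightarrow> (\<exists>I. bochner_has_integral M f I)"

definition bochner_integral :: "'a measure \<Rightarrow> ('a \<Rightarrow> 'b::real_normed_vector) \<Rightarrow> 'b" where
  "bochner_integral M f =
     (if bochner_integrable M f then THE I. bochner_has_integral M f I else 0)"

section \<open>Lebesgue--Bochner spaces\<close>

definition Lp_norm :: "'a measure \<Rightarrow> real \<Rightarrow> ('a \<Rightarrow> 'b::real_normed_vector) \<Rightarrow> ennreal" where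
  "Lp_norm M p f =
     (let t = \<integral>\<^sup>+x. ennreal (norm (f x) powr p) \<partial>M
      in if t = \<infinity> then \<infinity> else ennreal (enn2real t powr (1 / p)))"

text \<open>Elements are functions, not classes modulo null sets.\<close>

definition Lp_space :: "'a measure \<Rightarrow> real \<Rightarrow> ('a \<Rightarrow> 'b::real_normed_vector) set" where
  "Lp_space M p = {f. strongly_measurable M f \<and> Lp_norm M p f < \<infinity>}"

section \<open>Convolution and transference operators\<close>

text \<open>Integrals are taken with respect to the completion of the Haar measure. In this way
  alterations on null sets affect neither measurability nor integrals, even where the values
  on the null set are not contained in a separable subspace.\<close>

definition convolution ::
    "'g::{topological_ab_group_add, t2_space} measure \<Rightarrow>
     ('g \<Rightarrow> ('x::real_normed_vector \<Rightarrow>\<^sub>L 'y::real_normed_vector)) \<Rightarrow> ('g \<Rightarrow> 'x) \<Rightarrow> 'g \<Rightarrow> 'y" where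
  "convolution \<mu> K f v =
     bochner_integral (completion \<mu>) (\<lambda>u. blinfun_apply (K u) (f (v - u)))"

text \<open>The norm of the operator \<open>f \<mapsto> K * f\<close> from \<open>L\<^sup>p\<close> with values in the domain to \<open>L\<^sup>p\<close> with
  values in the codomain, as an extended real. For integrable \<open>K\<close> the integral defining
  \<open>K * f\<close> exists almost everywhere; the default value 0 elsewhere is irrelevant.\<close>

definition conv_op_norm ::
    "'g::{topological_ab_group_add, t2_space} measure \<Rightarrow> real \<Rightarrow>
     ('g \<Rightarrow> ('x::real_normed_vector \<Rightarrow>\<^sub>L 'y::real_normed_vector)) \<Rightarrow> ennreal" where
  "conv_op_norm \<mu> p K =
     (SUP f\<in>{f \<in> Lp_space (completion \<mu>) p. Lp_norm (completion \<mu>) p f \<le> 1}.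
        Lp_norm (completion \<mu>) p (convolution \<mu> K f))"

definition strongly_continuous_representation ::
    "('g::topological_ab_group_add \<Rightarrow> ('x::real_normed_vector \<Rightarrow>\<^sub>L 'x)) \<Rightarrow> bool" where
  "strongly_continuous_representation R \<longleftrightarrow>
     R 0 = id_blinfun \<and>
     (\<forall>u v. R (u + v) = R u o\<^sub>L R v) \<and>
     (\<forall>x. continuous_on UNIV (\<lambda>u. blinfun_apply (R u) x))"

definition transference_op ::
    "'g::{topological_ab_group_add, t2_space} measure \<Rightarrow>
     ('g \<Rightarrow> ('x::real_normed_vector \<Rightarrow>\<^sub>L 'y::real_normed_vector)) \<Rightarrow>
     ('g \<Rightarrow> ('x \<Rightarrow>\<^sub>L 'x)) \<Rightarrow> 'x \<Rightarrow> 'y" where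
  "transference_op \<mu> K R x =
     bochner_integral (completion \<mu>) (\<lambda>u. blinfun_apply (K u) (blinfun_apply (R (- u)) x))"

end

theory Submission
  imports Defs
begin

text \<open>
  Put \<open>g(u) = K(u) R\<^bsub>-u\<^esub> x\<close>, so that \<open>T\<^sub>K x = \<integral> g\<close>. By the intertwining property, convolving \<open>K\<close>
  with the truncated orbit \<open>f(w) = 1\<^bsub>W\<^esub>(w) R\<^sub>w x\<close> gives \<open>(K * f)(v) = R'\<^sub>v \<integral>\<^bsub>v-W\<^esub> g\<close>.
  Choose a compact \<open>C\<close> such that \<open>\<parallel>g\<parallel>\<close> has integral at most \<open>\<epsilon>\<close> off \<open>C\<close>. If \<open>V - C \<subseteq> W\<close>, then
  \<open>\<parallel>(K * f)(v)\<parallel> \<ge> (\<parallel>T\<^sub>K x\<parallel> - \<epsilon>) / c\<^sub>2\<close> at every point of \<open>V\<close>, whereas the \<open>L\<^sup>p\<close> norm of \<open>f\<close> is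
  at most \<open>c\<^sub>1 \<parallel>x\<parallel> \<mu>(W)\<^bsup>1/p\<^esup>\<close>. The bound follows because \<open>\<mu>(W)/\<mu>(V)\<close> can be made arbitrarily
  close to 1: the \<open>n\<close>-fold sumsets of a compact neighbourhood of 0 in an abelian group
  grow only polynomially in \<open>n\<close>. Since the lower bound is pointwise, neither Fubini's theorem
  nor Young's inequality is needed.
\<close>

section \<open>Bochner integrals over a complete measure\<close>

lemma ennreal_tendsto_0_le:
  fixes X Y :: "nat \<Rightarrow> ennreal"
  assumes "\<And>n. X n \<le> Y n" "Y \<longlonglongrightarrow> 0"
  shows "X \<longlonglongrightarrow> 0"
  by (rule tendsto_sandwich[OF _ _ tendsto_const assms(2)]) (simp_all add: assms(1))

context complete_measure
begin

text \<open>The two preimages of a Borel set differ by a subset of a null set, which is measurable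
  by completeness. This is how \<open>strongly_measurable\<close>, which asks for convergence only
  almost everywhere, can yield measurable norms.\<close>

lemma borel_measurable_cong_AE:
  fixes g h :: "'a \<Rightarrow> 'b::topological_space"
  assumes g: "g \<in> borel_measurable M" and ae: "AE x in M. g x = h x"
  shows "h \<in> borel_measurable M"
proof (rule measurableI)
  fix A :: "'b set" assume "A \<in> sets borel"
  then have A: "g -` A \<inter> space M \<in> sets M" using g by measurable
  have "AE x in M. x \<in> g -` A \<inter> space M \<longleftrightarrow> x \<in> h -` A \<inter> space M"
    using ae by eventually_elim auto
  then show "h -` A \<inter> space M \<in> sets M"
    by (rule in_sets_AE[OF _ A]) auto
qed simp

section \<open>Strong measurability and its closure properties\<close>

lemma strongly_measurable_norm:
  assumes "strongly_measurable M f"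
  shows "(\<lambda>x. norm (f x)) \<in> borel_measurable M"
proof -
  obtain s where s: "\<And>n. simple_function M (s n)" "AE x in M. (\<lambda>n::nat. s n x) \<longlonglongrightarrow> f x"
    using assms unfolding strongly_measurable_def by blast
  have [measurable]: "(\<lambda>x. norm (s n x)) \<in> borel_measurable M" for n
    by (rule borel_measurable_simple_function[OF simple_function_compose1[OF s(1)]])
  show ?thesis
  proof (rule borel_measurable_cong_AE)
    \<comment> \<open>Where the sequence diverges, \<open>lim\<close> has an unspecified value, but
      such points lie in a null set.\<close>
    show "(\<lambda>x. lim (\<lambda>n. norm (s n x))) \<in> borel_measurable M" by measurable
    show "AE x in M. lim (\<lambda>n. norm (s n x)) = norm (f x)"
      using s(2) by eventually_elim (intro limI tendsto_norm)
  qed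
qed

lemma strongly_measurable_simple: "simple_function M s \<Longrightarrow> strongly_measurable M s"
  unfolding strongly_measurable_def by (rule exI[of _ "\<lambda>_. s"]) auto

text \<open>Any function of two simple functions takes finitely many values and is again simple;
  continuity of \<open>h\<close> enters in passing to the limit.\<close>

lemma strongly_measurable_compose2:
  assumes "strongly_measurable M f" "strongly_measurable M g"
    and h: "continuous_on UNIV (\<lambda>p. h (fst p) (snd p))"
  shows "strongly_measurable M (\<lambda>x. h (f x) (g x))"
proof -
  obtain s where s: "\<And>n. simple_function M (s n)" "AE x in M. (\<lambda>n::nat. s n x) \<longlonglongrightarrow> f x"
    using assms unfolding strongly_measurable_def by blast
  obtain t where t: "\<And>n. simple_function M (t n)" "AE x in M. (\<lambda>n::nat. t n x) \<longlonglongrightarrow> g x"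
    using assms unfolding strongly_measurable_def by blast
  have "AE x in M. (\<lambda>n. h (s n x) (t n x)) \<longlonglongrightarrow> h (f x) (g x)"
    using s(2) t(2)
  proof eventually_elim
    case (elim x)
    have "((\<lambda>p. h (fst p) (snd p)) \<longlongrightarrow> h (f x) (g x)) (at (f x, g x))"
      using h by (auto simp: continuous_on_def)
    from isCont_tendsto_compose[of "(f x, g x)" "\<lambda>p. h (fst p) (snd p)", OF _ tendsto_Pair[OF elim]] this
    show ?case by (auto simp: isCont_def)
  qed
  then show ?thesis
    unfolding strongly_measurable_def
    by (intro exI[of _ "\<lambda>n x. h (s n x) (t n x)"]) (auto intro: simple_function_compose2 s t)
qed

lemma strongly_measurable_compose:
  assumes "strongly_measurable M f" "continuous_on UNIV h"
  shows "strongly_measurable M (\<lambda>x. h (f x))"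
  by (rule strongly_measurable_compose2[OF assms(1,1), where h="\<lambda>a _. h a"])
     (rule continuous_on_compose2[OF assms(2) continuous_on_fst[OF continuous_on_id]], simp)

lemma strongly_measurable_diff:
  "strongly_measurable M f \<Longrightarrow> strongly_measurable M g \<Longrightarrow> strongly_measurable M (\<lambda>x. f x - g x)"
  by (rule strongly_measurable_compose2[where h="(-)"]) (auto intro!: continuous_intros)

lemma strongly_measurable_add:
  "strongly_measurable M f \<Longrightarrow> strongly_measurable M g \<Longrightarrow> strongly_measurable M (\<lambda>x. f x + g x)"
  by (rule strongly_measurable_compose2[where h="(+)"]) (auto intro!: continuous_intros)

lemma strongly_measurable_indicator_scaleR:
  assumes "strongly_measurable M f" "A \<in> sets M"
  shows "strongly_measurable M (\<lambda>x. indicator A x *\<^sub>R f x)"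
  using strongly_measurable_simple[OF simple_function_indicator[OF assms(2)]] assms(1)
  by (rule strongly_measurable_compose2[where h="\<lambda>a b. a *\<^sub>R b"]) (intro continuous_intros)

section \<open>Approximation in L^1 by simple functions\<close>

lemma strongly_measurable_norm_diff_simple:
  assumes "strongly_measurable M f" "Bochner_Integration.simple_bochner_integrable M s"
  shows "(\<lambda>x. ennreal (norm (f x - s x))) \<in> borel_measurable M"
proof -
  have "strongly_measurable M s"
    using assms(2) by (auto elim: simple_bochner_integrable.cases intro: strongly_measurable_simple)
  from strongly_measurable_norm[OF strongly_measurable_diff[OF assms(1) this]]
  show ?thesis by measurable
qed

text \<open>Cutting the simple functions off where they exceed twice the norm of \<open>f\<close>
  gives three times that norm as an integrable majorant, and dominated convergence turns almost
  everywhere convergence into convergence in L^1.\<close>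

lemma strongly_measurable_L1_approx:
  assumes f: "strongly_measurable M f" and fin: "(\<integral>\<^sup>+x. ennreal (norm (f x)) \<partial>M) < \<infinity>"
  obtains s where "\<And>n. Bochner_Integration.simple_bochner_integrable M (s n)"
    "(\<lambda>n::nat. \<integral>\<^sup>+x. ennreal (norm (f x - s n x)) \<partial>M) \<longlonglongrightarrow> 0"
proof -
  obtain s where s: "\<And>n. simple_function M (s n)" "AE x in M. (\<lambda>n::nat. s n x) \<longlonglongrightarrow> f x"
    using f unfolding strongly_measurable_def by blast
  note [measurable] = strongly_measurable_norm[OF f]
  have [measurable]: "(\<lambda>x. norm (s n x)) \<in> borel_measurable M" for n
    by (rule borel_measurable_simple_function[OF simple_function_compose1[OF s(1)]])
  \<comment> \<open>Any factor above 1 would serve: where \<open>f x\<close> is nonzero the cut-off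
    is eventually inactive, and where \<open>f x = 0\<close> it forces \<open>t n x = 0\<close>,
    which is the right limit.\<close>
  define t where "t n x = (if norm (s n x) \<le> 2 * norm (f x) then s n x else 0)" for n x
  have t: "simple_function M (t n)" for n
    unfolding t_def by (intro simple_function_If s) (simp, measurable)
  have le: "norm (t n x) \<le> 2 * norm (f x)" for n x
    by (auto simp: t_def)
  have "(\<integral>\<^sup>+x. ennreal (norm (t n x)) \<partial>M) \<le> (\<integral>\<^sup>+x. 2 * ennreal (norm (f x)) \<partial>M)" for n
  proof (intro nn_integral_mono)
    fix x
    have "ennreal (norm (t n x)) \<le> ennreal (2 * norm (f x))" by (intro ennreal_leI le)
    then show "ennreal (norm (t n x)) \<le> 2 * ennreal (norm (f x))" by (simp add: ennreal_mult')
  qed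
  also have "\<dots> = 2 * (\<integral>\<^sup>+x. ennreal (norm (f x)) \<partial>M)"
    by (intro nn_integral_cmult) measurable
  also have "\<dots> < \<infinity>" using fin by (simp add: ennreal_mult_less_top)
  finally have sbi: "Bochner_Integration.simple_bochner_integrable M (t n)" for n
    by (intro simple_bochner_integrableI_bounded t)
  have lim: "AE x in M. (\<lambda>n. ennreal (norm (f x - t n x))) \<longlonglongrightarrow> 0"
    using s(2)
  proof eventually_elim
    case (elim x)
    have "(\<lambda>n. t n x) \<longlonglongrightarrow> f x"
    proof (cases "f x = 0")
      case True
      show ?thesis
        using True le[of _ x] by simp
    next
      case False
      have "eventually (\<lambda>n. norm (s n x) < 2 * norm (f x)) sequentially"
        by (rule order_tendstoD(2)[OF tendsto_norm[OF elim]]) (use False in auto)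
      then have "eventually (\<lambda>n. s n x = t n x) sequentially"
        by eventually_elim (auto simp: t_def)
      with elim show ?thesis by (rule Lim_transform_eventually)
    qed
    then have "(\<lambda>n. norm (f x - t n x)) \<longlonglongrightarrow> norm (f x - f x)"
      by (intro tendsto_intros)
    then show ?case by (auto intro: tendsto_ennrealI simp flip: ennreal_0)
  qed
  have "(\<lambda>n. \<integral>\<^sup>+x. ennreal (norm (f x - t n x)) \<partial>M) \<longlonglongrightarrow> (\<integral>\<^sup>+x. 0 \<partial>M)"
  proof (rule nn_integral_dominated_convergence[where w="\<lambda>x. 3 * ennreal (norm (f x))"])
    show "(\<lambda>x. ennreal (norm (f x - t n x))) \<in> borel_measurable M" for n
      by (rule strongly_measurable_norm_diff_simple[OF f sbi])
    show "AE x in M. ennreal (norm (f x - t n x)) \<le> 3 * ennreal (norm (f x))" for n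
    proof (rule AE_I2)
      fix x
      have "norm (f x - t n x) \<le> 3 * norm (f x)"
        using norm_triangle_ineq4[of "f x" "t n x"] le[of n x] by simp
      then have "ennreal (norm (f x - t n x)) \<le> ennreal (3 * norm (f x))" by (rule ennreal_leI)
      then show "ennreal (norm (f x - t n x)) \<le> 3 * ennreal (norm (f x))"
        by (simp add: ennreal_mult')
    qed
    have "(\<integral>\<^sup>+x. 3 * ennreal (norm (f x)) \<partial>M) = 3 * (\<integral>\<^sup>+x. ennreal (norm (f x)) \<partial>M)"
      by (intro nn_integral_cmult) measurable
    then show "(\<integral>\<^sup>+x. 3 * ennreal (norm (f x)) \<partial>M) < \<infinity>"
      using fin by (simp add: ennreal_mult_less_top)
  qed (use lim in auto)
  with sbi show thesis by (intro that) auto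
qed

section \<open>Uniqueness, existence and norm bound of the Bochner integral\<close>

lemma norm_simple_bochner_integral_le:
  assumes "Bochner_Integration.simple_bochner_integrable M s"
  shows "ennreal (norm (Bochner_Integration.simple_bochner_integral M s)) \<le> (\<integral>\<^sup>+x. ennreal (norm (s x)) \<partial>M)"
proof -
  have "Bochner_Integration.simple_bochner_integrable M (\<lambda>x. norm (s x))"
    using simple_bochner_integrable_compose2[OF _ assms assms, of "\<lambda>a _. norm a"] by simp
  from simple_bochner_integral_eq_nn_integral[OF this] simple_bochner_integral_norm_bound[OF assms]
  show ?thesis
    by (metis ennreal_leI norm_ge_zero)
qed

text \<open>The triangle inequality inserts \<open>f\<close> between \<open>s\<close> and
  \<open>t\<close>. This one estimate yields uniqueness of the integral, the Cauchy property of
  approximating sums and, with \<open>t = 0\<close>, the norm bound.\<close>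

lemma norm_simple_bochner_integral_diff_le:
  assumes f: "strongly_measurable M f"
    and s: "Bochner_Integration.simple_bochner_integrable M s"
    and t: "Bochner_Integration.simple_bochner_integrable M t"
  shows "ennreal (norm (Bochner_Integration.simple_bochner_integral M s - Bochner_Integration.simple_bochner_integral M t))
     \<le> (\<integral>\<^sup>+x. ennreal (norm (f x - s x)) \<partial>M) + (\<integral>\<^sup>+x. ennreal (norm (f x - t x)) \<partial>M)"
proof -
  have "ennreal (norm (Bochner_Integration.simple_bochner_integral M s - Bochner_Integration.simple_bochner_integral M t))
    \<le> (\<integral>\<^sup>+x. ennreal (norm (s x - t x)) \<partial>M)"
    using norm_simple_bochner_integral_le[OF simple_bochner_integrable_compose2[OF _ s t, of "(-)"]]
    by (simp add: simple_bochner_integral_diff[OF s t])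
  also have "\<dots> \<le> (\<integral>\<^sup>+x. ennreal (norm (f x - s x)) + ennreal (norm (f x - t x)) \<partial>M)"
  proof (intro nn_integral_mono)
    fix x
    have "norm (s x - t x) \<le> norm (f x - s x) + norm (f x - t x)"
      using norm_triangle_ineq4[of "f x - t x" "f x - s x"] by (simp add: algebra_simps)
    then have "ennreal (norm (s x - t x)) \<le> ennreal (norm (f x - s x) + norm (f x - t x))"
      by (rule ennreal_leI)
    then show "ennreal (norm (s x - t x)) \<le> ennreal (norm (f x - s x)) + ennreal (norm (f x - t x))"
      by (simp add: ennreal_plus)
  qed
  also have "\<dots> = (\<integral>\<^sup>+x. ennreal (norm (f x - s x)) \<partial>M) + (\<integral>\<^sup>+x. ennreal (norm (f x - t x)) \<partial>M)"
    by (intro nn_integral_add strongly_measurable_norm_diff_simple f s t)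
  finally show ?thesis .
qed

lemma bochner_has_integral_unique:
  assumes "bochner_has_integral M f I" "bochner_has_integral M f J"
  shows "I = J"
proof -
  have f: "strongly_measurable M f" using assms by (auto simp: bochner_has_integral_def)
  obtain s where s: "\<And>n. Bochner_Integration.simple_bochner_integrable M (s n)"
    "(\<lambda>n::nat. \<integral>\<^sup>+x. ennreal (norm (f x - s n x)) \<partial>M) \<longlonglongrightarrow> 0"
    "(\<lambda>n. Bochner_Integration.simple_bochner_integral M (s n)) \<longlonglongrightarrow> I"
    using assms(1) by (auto simp: bochner_has_integral_def)
  obtain t where t: "\<And>n. Bochner_Integration.simple_bochner_integrable M (t n)"
    "(\<lambda>n::nat. \<integral>\<^sup>+x. ennreal (norm (f x - t n x)) \<partial>M) \<longlonglongrightarrow> 0"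
    "(\<lambda>n. Bochner_Integration.simple_bochner_integral M (t n)) \<longlonglongrightarrow> J"
    using assms(2) by (auto simp: bochner_has_integral_def)
  have "(\<lambda>n. ennreal (norm (Bochner_Integration.simple_bochner_integral M (s n)
            - Bochner_Integration.simple_bochner_integral M (t n)))) \<longlonglongrightarrow> ennreal (norm (I - J))"
    by (intro tendsto_intros s t)
  moreover have "(\<lambda>n. (\<integral>\<^sup>+x. ennreal (norm (f x - s n x)) \<partial>M) + (\<integral>\<^sup>+x. ennreal (norm (f x - t n x)) \<partial>M))
     \<longlonglongrightarrow> 0 + 0"
    by (intro tendsto_add s t)
  ultimately have "ennreal (norm (I - J)) \<le> 0 + 0"
    by (rule LIMSEQ_le) (blast intro: norm_simple_bochner_integral_diff_le f s t)
  then show ?thesis by simp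
qed

lemma bochner_integral_eq: "bochner_has_integral M f I \<Longrightarrow> bochner_integral M f = I"
  unfolding bochner_integral_def bochner_integrable_def
  by (auto intro: bochner_has_integral_unique)

lemma bochner_has_integral_bochner_integral:
  "bochner_integrable M f \<Longrightarrow> bochner_has_integral M f (bochner_integral M f)"
  using bochner_integral_eq by (auto simp: bochner_integrable_def)

lemma bochner_integrableI:
  fixes f :: "'a \<Rightarrow> 'b::banach"
  assumes f: "strongly_measurable M f" and fin: "(\<integral>\<^sup>+x. ennreal (norm (f x)) \<partial>M) < \<infinity>"
  shows "bochner_integrable M f"
proof -
  from strongly_measurable_L1_approx[OF assms]
  obtain s where s: "\<And>n. Bochner_Integration.simple_bochner_integrable M (s n)"
    "(\<lambda>n::nat. \<integral>\<^sup>+x. ennreal (norm (f x - s n x)) \<partial>M) \<longlonglongrightarrow> 0" by blast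
  have "Cauchy (\<lambda>n. Bochner_Integration.simple_bochner_integral M (s n))"
  proof (rule CauchyI)
    fix e :: real assume "0 < e"
    then have "eventually (\<lambda>n. (\<integral>\<^sup>+x. ennreal (norm (f x - s n x)) \<partial>M) < ennreal (e/2)) sequentially"
      by (intro order_tendstoD(2)[OF s(2)]) auto
    then obtain N where N: "\<And>n. n \<ge> N \<Longrightarrow> (\<integral>\<^sup>+x. ennreal (norm (f x - s n x)) \<partial>M) < ennreal (e/2)"
      by (auto simp: eventually_sequentially)
    have "norm (Bochner_Integration.simple_bochner_integral M (s m) - Bochner_Integration.simple_bochner_integral M (s n)) < e"
      if "m \<ge> N" "n \<ge> N" for m n
    proof -
      have "ennreal (norm (Bochner_Integration.simple_bochner_integral M (s m) - Bochner_Integration.simple_bochner_integral M (s n)))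
         \<le> (\<integral>\<^sup>+x. ennreal (norm (f x - s m x)) \<partial>M) + (\<integral>\<^sup>+x. ennreal (norm (f x - s n x)) \<partial>M)"
        by (intro norm_simple_bochner_integral_diff_le f s)
      also have "\<dots> < ennreal (e/2) + ennreal (e/2)"
        by (intro add_strict_mono N that)
      also have "\<dots> = ennreal e" using \<open>0 < e\<close> by (simp flip: ennreal_plus)
      finally show ?thesis by (simp add: ennreal_less_iff)
    qed
    then show "\<exists>N. \<forall>m\<ge>N. \<forall>n\<ge>N. norm (Bochner_Integration.simple_bochner_integral M (s m)
       - Bochner_Integration.simple_bochner_integral M (s n)) < e" by blast
  qed
  then have "convergent (\<lambda>n. Bochner_Integration.simple_bochner_integral M (s n))"
    by (rule Cauchy_convergent)
  with f s show ?thesis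
    unfolding bochner_integrable_def bochner_has_integral_def convergent_def by blast
qed

lemma bochner_has_integral_norm_le:
  assumes "bochner_has_integral M f I"
  shows "ennreal (norm I) \<le> (\<integral>\<^sup>+x. ennreal (norm (f x)) \<partial>M)"
proof -
  have f: "strongly_measurable M f" using assms by (auto simp: bochner_has_integral_def)
  obtain s where s: "\<And>n. Bochner_Integration.simple_bochner_integrable M (s n)"
    "(\<lambda>n::nat. \<integral>\<^sup>+x. ennreal (norm (f x - s n x)) \<partial>M) \<longlonglongrightarrow> 0"
    "(\<lambda>n. Bochner_Integration.simple_bochner_integral M (s n)) \<longlonglongrightarrow> I"
    using assms(1) by (auto simp: bochner_has_integral_def)
  \<comment> \<open>Comparing \<open>s n\<close> with the zero function turns the estimate for
    differences into a bound on the integral of \<open>s n\<close> itself.\<close>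
  have z: "Bochner_Integration.simple_bochner_integrable M (\<lambda>_. 0 :: 'b)"
    by (rule simple_bochner_integrable.intros) auto
  have z0: "Bochner_Integration.simple_bochner_integral M (\<lambda>_. 0 :: 'b) = 0"
    by (auto simp: Bochner_Integration.simple_bochner_integral_def intro!: sum.neutral)
  have "(\<lambda>n. ennreal (norm (Bochner_Integration.simple_bochner_integral M (s n)))) \<longlonglongrightarrow> ennreal (norm I)"
    by (intro tendsto_intros s)
  moreover have "(\<lambda>n. (\<integral>\<^sup>+x. ennreal (norm (f x - s n x)) \<partial>M) + (\<integral>\<^sup>+x. ennreal (norm (f x)) \<partial>M))
     \<longlonglongrightarrow> 0 + (\<integral>\<^sup>+x. ennreal (norm (f x)) \<partial>M)"
    by (intro tendsto_add s tendsto_const)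
  moreover have "ennreal (norm (Bochner_Integration.simple_bochner_integral M (s n))) \<le>
      (\<integral>\<^sup>+x. ennreal (norm (f x - s n x)) \<partial>M) + (\<integral>\<^sup>+x. ennreal (norm (f x)) \<partial>M)" for n
    using norm_simple_bochner_integral_diff_le[OF f s(1)[of n] z] by (simp add: z0)
  ultimately have "ennreal (norm I) \<le> 0 + (\<integral>\<^sup>+x. ennreal (norm (f x)) \<partial>M)"
    by (blast intro: LIMSEQ_le)
  then show ?thesis by simp
qed

section \<open>Linearity of the Bochner integral\<close>

lemma bochner_has_integral_linear:
  assumes "bochner_has_integral M f I" "bounded_linear L"
  shows "bochner_has_integral M (\<lambda>x. L (f x)) (L I)"
proof -
  interpret L: bounded_linear L by fact
  have f: "strongly_measurable M f" using assms by (auto simp: bochner_has_integral_def)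
  obtain s where s: "\<And>n. Bochner_Integration.simple_bochner_integrable M (s n)"
    "(\<lambda>n::nat. \<integral>\<^sup>+x. ennreal (norm (f x - s n x)) \<partial>M) \<longlonglongrightarrow> 0"
    "(\<lambda>n. Bochner_Integration.simple_bochner_integral M (s n)) \<longlonglongrightarrow> I"
    using assms(1) by (auto simp: bochner_has_integral_def)
  obtain B where B: "\<And>x. norm (L x) \<le> norm x * B" "0 < B" using L.pos_bounded by blast
  have "(\<integral>\<^sup>+x. ennreal (norm (L (f x) - L (s n x))) \<partial>M) \<le> ennreal B * (\<integral>\<^sup>+x. ennreal (norm (f x - s n x)) \<partial>M)" for n
  proof -
    have "(\<integral>\<^sup>+x. ennreal (norm (L (f x) - L (s n x))) \<partial>M) \<le> (\<integral>\<^sup>+x. ennreal B * ennreal (norm (f x - s n x)) \<partial>M)"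
    proof (intro nn_integral_mono)
      fix x
      have "ennreal (norm (L (f x) - L (s n x))) \<le> ennreal (B * norm (f x - s n x))"
        using B(1)[of "f x - s n x"] by (intro ennreal_leI) (simp add: L.diff mult.commute)
      then show "ennreal (norm (L (f x) - L (s n x))) \<le> ennreal B * ennreal (norm (f x - s n x))"
        using B(2) by (simp add: ennreal_mult)
    qed
    also have "\<dots> = ennreal B * (\<integral>\<^sup>+x. ennreal (norm (f x - s n x)) \<partial>M)"
      by (intro nn_integral_cmult strongly_measurable_norm_diff_simple f s)
    finally show ?thesis .
  qed
  moreover have "(\<lambda>n. ennreal B * (\<integral>\<^sup>+x. ennreal (norm (f x - s n x)) \<partial>M)) \<longlonglongrightarrow> 0"
    using ennreal_tendsto_cmult[OF _ s(2), of "ennreal B"] by simp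
  ultimately have "(\<lambda>n. \<integral>\<^sup>+x. ennreal (norm (L (f x) - L (s n x))) \<partial>M) \<longlonglongrightarrow> 0"
    by (rule ennreal_tendsto_0_le)
  moreover have "(\<lambda>n. Bochner_Integration.simple_bochner_integral M (\<lambda>x. L (s n x))) \<longlonglongrightarrow> L I"
    by (subst simple_bochner_integral_linear[OF L.linear s(1)]) (intro L.tendsto s)
  moreover have "Bochner_Integration.simple_bochner_integrable M (\<lambda>x. L (s n x))" for n
    using simple_bochner_integrable_compose2[OF _ s(1) s(1), of "\<lambda>a _. L a"] by (simp add: L.zero)
  moreover have "strongly_measurable M (\<lambda>x. L (f x))"
    by (rule strongly_measurable_compose[OF f]) (auto intro: L.continuous_on)
  ultimately show ?thesis
    unfolding bochner_has_integral_def by (intro conjI exI[of _ "\<lambda>n x. L (s n x)"]) auto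
qed

lemma bochner_has_integral_add:
  assumes "bochner_has_integral M f I" "bochner_has_integral M g J"
  shows "bochner_has_integral M (\<lambda>x. f x + g x) (I + J)"
proof -
  have f: "strongly_measurable M f" using assms by (auto simp: bochner_has_integral_def)
  have g: "strongly_measurable M g" using assms by (auto simp: bochner_has_integral_def)
  obtain s where s: "\<And>n. Bochner_Integration.simple_bochner_integrable M (s n)"
    "(\<lambda>n::nat. \<integral>\<^sup>+x. ennreal (norm (f x - s n x)) \<partial>M) \<longlonglongrightarrow> 0"
    "(\<lambda>n. Bochner_Integration.simple_bochner_integral M (s n)) \<longlonglongrightarrow> I"
    using assms(1) by (auto simp: bochner_has_integral_def)
  obtain t where t: "\<And>n. Bochner_Integration.simple_bochner_integrable M (t n)"
    "(\<lambda>n::nat. \<integral>\<^sup>+x. ennreal (norm (g x - t n x)) \<partial>M) \<longlonglongrightarrow> 0"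
    "(\<lambda>n. Bochner_Integration.simple_bochner_integral M (t n)) \<longlonglongrightarrow> J"
    using assms(2) by (auto simp: bochner_has_integral_def)
  have "(\<integral>\<^sup>+x. ennreal (norm (f x + g x - (s n x + t n x))) \<partial>M)
     \<le> (\<integral>\<^sup>+x. ennreal (norm (f x - s n x)) \<partial>M) + (\<integral>\<^sup>+x. ennreal (norm (g x - t n x)) \<partial>M)" for n
  proof -
    have "(\<integral>\<^sup>+x. ennreal (norm (f x + g x - (s n x + t n x))) \<partial>M)
      \<le> (\<integral>\<^sup>+x. ennreal (norm (f x - s n x)) + ennreal (norm (g x - t n x)) \<partial>M)"
    proof (intro nn_integral_mono)
      fix x
      have "ennreal (norm (f x + g x - (s n x + t n x))) \<le> ennreal (norm (f x - s n x) + norm (g x - t n x))"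
        by (intro ennreal_leI norm_diff_triangle_ineq)
      then show "ennreal (norm (f x + g x - (s n x + t n x))) \<le> ennreal (norm (f x - s n x)) + ennreal (norm (g x - t n x))"
        by (simp add: ennreal_plus)
    qed
    also have "\<dots> = (\<integral>\<^sup>+x. ennreal (norm (f x - s n x)) \<partial>M) + (\<integral>\<^sup>+x. ennreal (norm (g x - t n x)) \<partial>M)"
      by (intro nn_integral_add strongly_measurable_norm_diff_simple f s g t)
    finally show ?thesis .
  qed
  moreover have "(\<lambda>n. (\<integral>\<^sup>+x. ennreal (norm (f x - s n x)) \<partial>M) + (\<integral>\<^sup>+x. ennreal (norm (g x - t n x)) \<partial>M)) \<longlonglongrightarrow> 0"
    using tendsto_add[OF s(2) t(2)] by simp
  ultimately have "(\<lambda>n. \<integral>\<^sup>+x. ennreal (norm (f x + g x - (s n x + t n x))) \<partial>M) \<longlonglongrightarrow> 0"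
    by (rule ennreal_tendsto_0_le)
  moreover have "(\<lambda>n. Bochner_Integration.simple_bochner_integral M (\<lambda>x. s n x + t n x)) \<longlonglongrightarrow> I + J"
    by (subst simple_bochner_integral_add[OF s(1) t(1)]) (intro tendsto_intros s t)
  moreover have "Bochner_Integration.simple_bochner_integrable M (\<lambda>x. s n x + t n x)" for n
    using simple_bochner_integrable_compose2[OF _ s(1) t(1), of "(+)"] by simp
  ultimately show ?thesis
    unfolding bochner_has_integral_def
    by (intro conjI exI[of _ "\<lambda>n x. s n x + t n x"] strongly_measurable_add f g) auto
qed

end

section \<open>A Folner condition for Haar measure\<close>

definition sumset :: "'g::ab_group_add set \<Rightarrow> 'g set \<Rightarrow> 'g set" where
  "sumset A B = (\<lambda>p. fst p + snd p) ` (A \<times> B)"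

lemma sumsetI: "a \<in> A \<Longrightarrow> b \<in> B \<Longrightarrow> a + b \<in> sumset A B"
  unfolding sumset_def by (intro image_eqI[of _ _ "(a, b)"]) auto

lemma sumsetE:
  assumes "x \<in> sumset A B"
  obtains a b where "a \<in> A" "b \<in> B" "x = a + b"
  using assms unfolding sumset_def by auto

text \<open>Encoding the sumset as the image of a product under addition makes compactness a matter
  of products and continuous images.\<close>

lemma compact_sumset:
  fixes A B :: "'g::{topological_ab_group_add} set"
  shows "compact A \<Longrightarrow> compact B \<Longrightarrow> compact (sumset A B)"
  unfolding sumset_def
  by (intro compact_continuous_image continuous_intros compact_Times)

text \<open>The number of translates is at most \<open>(n + 1)\<close> to the power \<open>card F\<close>: a sum of \<open>n\<close> elements
  of \<open>F\<close> depends only on the multiplicities \<open>m f\<close>. Multiples in a group are written as iterated sums.\<close>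

lemma sumset_iterate_subset:
  fixes D F :: "'g::ab_group_add set"
  assumes F: "finite F" and DD: "sumset D D \<subseteq> sumset F D"
  shows "(sumset D ^^ n) D \<subseteq> (\<Union>m\<in>PiE F (\<lambda>_. {..n}). (+) (\<Sum>f\<in>F. \<Sum>i<m f. f) ` D)"
proof (induction n)
  case 0
  have "(+) (\<Sum>f\<in>F. \<Sum>i<(restrict (\<lambda>_. 0::nat) F) f. f) ` D = D"
    by (auto simp: image_iff cong: sum.cong)
  moreover have "restrict (\<lambda>_. 0) F \<in> PiE F (\<lambda>_. {..0::nat})" by auto
  ultimately show ?case by fastforce
next
  case (Suc n)
  show ?case
  proof
    fix x assume "x \<in> (sumset D ^^ Suc n) D"
    then obtain d y where d: "d \<in> D" "y \<in> (sumset D ^^ n) D" "x = d + y"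
      by (auto elim: sumsetE)
    from subsetD[OF Suc d(2)] obtain m e
      where m: "m \<in> PiE F (\<lambda>_. {..n})" and e: "e \<in> D" "y = (\<Sum>f\<in>F. \<Sum>i<m f. f) + e"
      by (elim UN_E imageE)
    \<comment> \<open>The new summand \<open>d\<close> is absorbed into the old remainder
      \<open>e\<close>: their sum lies in some translate \<open>a + D\<close>, so one more summand
      costs one more copy of the single generator \<open>a\<close>.\<close>
    have "d + e \<in> sumset D D" by (rule sumsetI) fact+
    from subsetD[OF DD this] obtain a b where ab: "a \<in> F" "b \<in> D" "d + e = a + b"
      by (rule sumsetE)
    define m' where "m' = m(a := Suc (m a))"
    have "m' \<in> PiE F (\<lambda>_. {..Suc n})"
      using m ab(1) unfolding m'_def
      by (intro PiE_I) (auto simp: PiE_iff extensional_def le_SucI)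
    moreover have "x = (\<Sum>f\<in>F. \<Sum>i<m' f. f) + b"
    proof -
      have "(\<Sum>f\<in>F. \<Sum>i<m' f. f) = (\<Sum>i<m' a. a) + (\<Sum>f\<in>F - {a}. \<Sum>i<m' f. f)"
        by (rule sum.remove[OF F ab(1)])
      also have "(\<Sum>f\<in>F - {a}. \<Sum>i<m' f. f) = (\<Sum>f\<in>F - {a}. \<Sum>i<m f. f)"
        by (intro sum.cong) (auto simp: m'_def)
      also have "(\<Sum>i<m' a. a) = a + (\<Sum>i<m a. a)" by (simp add: m'_def add.commute)
      also have "a + (\<Sum>i<m a. a) + (\<Sum>f\<in>F - {a}. \<Sum>i<m f. f) = a + (\<Sum>f\<in>F. \<Sum>i<m f. f)"
        by (subst sum.remove[OF F ab(1), of "\<lambda>f. \<Sum>i<m f. f"]) (simp add: add.assoc)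
      finally have "(\<Sum>f\<in>F. \<Sum>i<m' f. f) + b = (\<Sum>f\<in>F. \<Sum>i<m f. f) + (a + b)"
        by (simp add: ac_simps)
      then show ?thesis
        unfolding ab(3)[symmetric] d(3) e(2) by (simp add: ac_simps)
    qed
    ultimately show "x \<in> (\<Union>m\<in>PiE F (\<lambda>_. {..Suc n}). (+) (\<Sum>f\<in>F. \<Sum>i<m f. f) ` D)"
      using ab(2) by blast
  qed
qed

text \<open>With \<open>q\<close> the root of \<open>c\<close> of order \<open>k + 1\<close>, linear
  growth loses against \<open>q ^ n\<close>; raising \<open>n + 1 < q ^ n\<close> to the power
  \<open>k + 1\<close> gives more than is claimed. Order \<open>k + 1\<close> instead of
  \<open>k\<close> covers \<open>k = 0\<close>.\<close>

lemma polynomial_less_exponential: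
  fixes c :: real
  assumes "1 < c"
  shows "\<exists>n. real (Suc n) ^ k < c ^ n"
proof -
  define q where "q = root (Suc k) c"
  have q: "1 < q" "q ^ Suc k = c"
    using assms real_root_pow_pos2[of "Suc k" c] by (simp_all add: q_def del: power_Suc)
  have "(\<lambda>n. of_nat n * (1/q) ^ n) \<longlonglongrightarrow> (0::real)"
    by (rule powser_times_n_limit_0) (use q in auto)
  then have "(\<lambda>n. q * (of_nat (Suc n) * (1/q) ^ Suc n)) \<longlonglongrightarrow> q * (0::real)"
    by (intro tendsto_intros LIMSEQ_Suc)
  then have "eventually (\<lambda>n. q * (of_nat (Suc n) * (1/q) ^ Suc n) < (1::real)) sequentially"
    by (intro order_tendstoD) auto
  then obtain n where n: "q * (real (Suc n) * (1/q) ^ Suc n) < 1" "n > 0"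
    by (metis (no_types, lifting) eventually_happens' eventually_conj eventually_gt_at_top sequentially_bot)
  then have "real (Suc n) < q ^ n"
  proof -
    have "q * (real (Suc n) * (1/q) ^ Suc n) = real (Suc n) / q ^ n"
      using q(1) by (simp add: power_divide)
    with n q(1) show ?thesis by (simp add: divide_less_eq del: of_nat_Suc)
  qed
  then have "real (Suc n) ^ Suc k < (q ^ n) ^ Suc k"
    by (intro power_strict_mono) auto
  also have "(q ^ n) ^ Suc k = c ^ n" by (metis q(2) power_mult mult.commute)
  finally have "real (Suc n) ^ Suc k < c ^ n" .
  moreover have "real (Suc n) ^ k \<le> real (Suc n) ^ Suc k"
    by (intro power_increasing) auto
  ultimately show ?thesis by (intro exI[of _ n]) linarith
qed

section \<open>Consequences of translation invariance\<close>

lemma haar_measure_translate: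
  assumes "haar_measure \<mu>" "A \<in> sets borel"
  shows "emeasure \<mu> ((+) a ` A) = emeasure \<mu> A"
  using assms by (auto simp: haar_measure_def)

lemma open_translate:
  fixes U :: "'g::topological_ab_group_add set"
  assumes "open U" shows "open ((+) a ` U)"
proof -
  have "(+) a ` U = (\<lambda>x. x - a) -` U"
    by (auto simp: image_iff algebra_simps) (metis add.commute diff_add_cancel)
  then show ?thesis
    using assms by (simp, intro open_vimage) (auto intro!: continuous_intros)
qed

text \<open>Finitely many translates of \<open>U\<close> cover any compact set. If \<open>U\<close>
  were null, all compact sets would be null, and inner regularity would make the whole group
  null.\<close>

lemma haar_measure_open_pos:
  fixes \<mu> :: "'g::{topological_ab_group_add, t2_space} measure"
  assumes \<mu>: "haar_measure \<mu>" and U: "open U" "0 \<in> U"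
  shows "emeasure \<mu> U > 0"
proof (rule ccontr)
  assume "\<not> emeasure \<mu> U > 0"
  then have 0: "emeasure \<mu> U = 0" by simp
  have sets: "sets \<mu> = sets borel" using \<mu> by (auto simp: haar_measure_def)
  have "emeasure \<mu> C = 0" if C: "compact C" for C
  proof -
    obtain F where F: "finite F" "C \<subseteq> (\<Union>c\<in>F. (+) c ` U)"
    proof (rule compactE_image[OF C, of C "\<lambda>c. (+) c ` U"])
      show "C \<subseteq> (\<Union>c\<in>C. (+) c ` U)" using U(2) by (intro subsetI UN_I image_eqI[of _ _ 0]) auto
    qed (use open_translate U in auto)
    have "emeasure \<mu> C \<le> emeasure \<mu> (\<Union>c\<in>F. (+) c ` U)"
      using F U by (intro emeasure_mono) (auto simp: sets intro!: sets.finite_UN borel_open open_translate)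
    also have "\<dots> \<le> (\<Sum>c\<in>F. emeasure \<mu> ((+) c ` U))"
      using F U by (intro emeasure_subadditive_finite) (auto simp: sets intro!: borel_open open_translate)
    also have "\<dots> = 0"
      using U by (simp add: haar_measure_translate[OF \<mu>] 0)
    finally show ?thesis by simp
  qed
  moreover have "emeasure \<mu> UNIV = (SUP C\<in>{C. compact C \<and> C \<subseteq> UNIV}. emeasure \<mu> C)"
    using \<mu> open_UNIV unfolding haar_measure_def by blast
  moreover have "\<dots> \<le> 0"
    using calculation by (intro SUP_least) auto
  ultimately have "emeasure \<mu> UNIV = 0" by simp
  then show False using \<mu> by (auto simp: haar_measure_def)
qed

text \<open>\<open>V\<close> and \<open>W\<close> are consecutive iterated sumsets of a compact
  neighbourhood \<open>D\<close> of 0. If the measure grew by more than the factor \<open>c\<close>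
  at every step, it would grow exponentially, against the polynomial bound.\<close>

lemma haar_measure_folner:
  fixes \<mu> :: "'g::{topological_ab_group_add, t2_space} measure"
  assumes lc: "locally_compact_space (euclidean :: 'g topology)" and \<mu>: "haar_measure \<mu>"
    and C: "compact C" and c: "1 < (c::real)"
  obtains V W where "compact V" "compact W" "emeasure \<mu> V > 0"
    "emeasure \<mu> W \<le> ennreal c * emeasure \<mu> V" "\<And>v x. v \<in> V \<Longrightarrow> x \<in> C \<Longrightarrow> v - x \<in> W"
proof -
  have sets: "sets \<mu> = sets borel" using \<mu> by (auto simp: haar_measure_def)
  have fin: "emeasure \<mu> K < \<infinity>" if "compact K" for K
    using that \<mu> by (auto simp: haar_measure_def)
  have "\<exists>U D0 :: 'g set. open U \<and> compact D0 \<and> 0 \<in> U \<and> U \<subseteq> D0"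
    using bspec[OF lc[unfolded locally_compact_space_def], of 0] by simp
  then obtain U D0 :: "'g set" where U: "open U" "0 \<in> U" "U \<subseteq> D0" "compact D0"
    by blast
  \<comment> \<open>Including \<open>-C\<close> makes \<open>v - x\<close> an element of
    \<open>D + P n\<close> for \<open>v\<close> in \<open>P n\<close> and \<open>x\<close> in
    \<open>C\<close>. Including \<open>U\<close> puts 0 into \<open>D\<close>, so that the sets
    \<open>P n\<close> increase, and gives \<open>D\<close> positive measure.\<close>
  define D where "D = D0 \<union> uminus ` C"
  have D: "compact D" "U \<subseteq> D" "uminus ` C \<subseteq> D"
    unfolding D_def using U C by (auto intro!: compact_Un compact_continuous_image continuous_intros)
  \<comment> \<open>The index is shifted: \<open>P 0\<close> is \<open>D\<close>, so
    \<open>P n\<close> consists of sums of \<open>n + 1\<close> elements.\<close>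
  define P where "P n = (sumset D ^^ n) D" for n
  have P_Suc: "P (Suc n) = sumset D (P n)" for n by (simp add: P_def)
  have P_compact: "compact (P n)" for n
    by (induction n) (auto simp: P_Suc D intro!: compact_sumset, simp add: P_def D)
  \<comment> \<open>\<open>F\<close> is chosen once, independently of \<open>n\<close>; its
    cardinality becomes the degree of the growth polynomial.\<close>
  obtain F where F: "finite F" "sumset D D \<subseteq> (\<Union>a\<in>F. (+) a ` U)"
  proof (rule compactE_image[OF compact_sumset[OF D(1) D(1)], of "sumset D D" "\<lambda>a. (+) a ` U"])
    show "sumset D D \<subseteq> (\<Union>a\<in>sumset D D. (+) a ` U)" using U(2) by (intro subsetI UN_I image_eqI[of _ _ 0]) auto
  qed (use open_translate U in auto)
  then have FD: "sumset D D \<subseteq> sumset F D"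
    using D(2) by (blast intro: sumsetI)
  have D_meas: "D \<in> sets borel" using D(1) by (auto intro: borel_closed compact_imp_closed)
  have growth: "emeasure \<mu> (P n) \<le> ennreal (real (Suc n) ^ card F) * emeasure \<mu> D" for n
  proof -
    let ?I = "PiE F (\<lambda>_. {..n})" and ?t = "\<lambda>m. (+) (\<Sum>f\<in>F. \<Sum>i<m f. f) ` D"
    have fin_I: "finite ?I" using F by (intro finite_PiE) auto
    have "compact (?t m)" for m
      by (intro compact_continuous_image continuous_intros D)
    then have meas: "?t m \<in> sets \<mu>" for m
      by (auto simp: sets intro: borel_closed compact_imp_closed)
    have "emeasure \<mu> (P n) \<le> emeasure \<mu> (\<Union>m\<in>?I. ?t m)"
      unfolding P_def using sumset_iterate_subset[OF F(1) FD, of n] meas fin_I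
      by (intro emeasure_mono sets.finite_UN) auto
    also have "\<dots> \<le> (\<Sum>m\<in>?I. emeasure \<mu> (?t m))"
      using meas fin_I by (intro emeasure_subadditive_finite) auto
    also have "\<dots> = of_nat (card ?I) * emeasure \<mu> D"
      by (simp add: haar_measure_translate[OF \<mu> D_meas])
    also have "of_nat (card ?I) = ennreal (real (Suc n) ^ card F)"
      using F by (simp add: card_PiE ennreal_of_nat_eq_real_of_nat)
    finally show ?thesis .
  qed
  have pos: "emeasure \<mu> D > 0"
  proof -
    have "0 < emeasure \<mu> U" by (rule haar_measure_open_pos[OF \<mu> U(1,2)])
    also have "\<dots> \<le> emeasure \<mu> D" using D D_meas by (intro emeasure_mono) (auto simp: sets)
    finally show ?thesis .
  qed
  have "\<exists>n. emeasure \<mu> (P (Suc n)) \<le> ennreal c * emeasure \<mu> (P n)"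
  proof (rule ccontr)
    assume "\<not> ?thesis"
    then have less: "ennreal c * emeasure \<mu> (P n) < emeasure \<mu> (P (Suc n))" for n
      by (auto simp: not_le)
    have "ennreal (c ^ n) * emeasure \<mu> D \<le> emeasure \<mu> (P n)" for n
    proof (induction n)
      case (Suc n)
      have "ennreal (c ^ Suc n) * emeasure \<mu> D = ennreal c * (ennreal (c ^ n) * emeasure \<mu> D)"
        using c by (simp add: ennreal_mult mult.assoc)
      also have "\<dots> \<le> ennreal c * emeasure \<mu> (P n)"
        by (intro mult_left_mono Suc) auto
      finally show ?case using less[of n] by simp
    qed (simp add: P_def)
    then have *: "ennreal (c ^ n) * emeasure \<mu> D \<le> ennreal (real (Suc n) ^ card F) * emeasure \<mu> D" for n
      using growth order_trans by blast
    obtain n where n: "real (Suc n) ^ card F < c ^ n"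
      using polynomial_less_exponential[OF c] by blast
    \<comment> \<open>The measure of \<open>D\<close> is positive and finite, hence may be
      cancelled.\<close>
    have "ennreal (c ^ n) \<le> ennreal (real (Suc n) ^ card F)"
      using *[of n] pos fin[OF D(1)]
      by (subst (asm) (1 2) mult.commute, subst (asm) ennreal_mult_le_mult_iff) auto
    with n show False by (auto simp: ennreal_le_iff)
  qed
  then obtain n where n: "emeasure \<mu> (P (Suc n)) \<le> ennreal c * emeasure \<mu> (P n)" by blast
  have P_pos: "emeasure \<mu> (P n) > 0" for n
  proof (induction n)
    case 0 then show ?case using pos by (simp add: P_def)
  next
    case (Suc n)
    have "P n \<subseteq> P (Suc n)"
      using sumsetI[of 0 D _ "P n"] U(2) D(2) by (auto simp: P_Suc)
    then have "emeasure \<mu> (P n) \<le> emeasure \<mu> (P (Suc n))"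
      by (intro emeasure_mono) (auto simp: sets intro!: borel_closed compact_imp_closed P_compact)
    with Suc show ?case by simp
  qed
  have "v - x \<in> P (Suc n)" if "v \<in> P n" "x \<in> C" for v x
    using sumsetI[of "-x" D v "P n"] that D(3) by (auto simp: P_Suc)
  then show thesis
    using that P_compact P_pos n by blast
qed

section \<open>Tightness and measurability along orbits\<close>

text \<open>Compactness takes the place of separability: finitely many balls of radius
  \<open>d\<close> cover the image of \<open>C\<close>, and their centres are the values of
  \<open>r\<close>.\<close>

lemma continuous_simple_approx:
  fixes \<phi> :: "'a::topological_space \<Rightarrow> 'b::real_normed_vector"
  assumes \<phi>: "continuous_on UNIV \<phi>" and C: "compact C" and d: "0 < d"
    and M: "sets borel \<subseteq> sets M" "space M = UNIV"
  obtains r where "simple_function M r" "\<And>u. u \<in> C \<Longrightarrow> norm (\<phi> u - r u) < d"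
proof -
  let ?B = "\<lambda>y. {u. norm (\<phi> u - y) < d}"
  have opn: "open (?B y)" for y
    by (intro open_Collect_less continuous_intros \<phi>)
  obtain Y where Y: "finite Y" "C \<subseteq> (\<Union>y\<in>Y. ?B y)"
  proof (rule compactE_image[OF C, of "UNIV" ?B])
    show "C \<subseteq> (\<Union>y. ?B y)" using d by auto (metis cancel_comm_monoid_add_class.diff_cancel norm_zero)
  qed (use opn in auto)
  \<comment> \<open>Induction over the centres builds a nested case distinction, which settles the
    overlaps of the balls.\<close>
  from Y(1) have "\<exists>r. simple_function M r \<and> (\<forall>u\<in>(\<Union>y\<in>Y. ?B y). norm (\<phi> u - r u) < d)"
  proof induction
    case empty
    show ?case by (intro exI[of _ "\<lambda>_. 0"]) auto
  next
    case (insert y Y)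
    then obtain r where r: "simple_function M r" "\<forall>u\<in>(\<Union>y\<in>Y. ?B y). norm (\<phi> u - r u) < d" by blast
    have "simple_function M (\<lambda>u. if norm (\<phi> u - y) < d then y else r u)"
      using opn[of y] M by (intro simple_function_If r) auto
    with r(2) show ?case
      by (intro exI[of _ "\<lambda>u. if norm (\<phi> u - y) < d then y else r u"]) auto
  qed
  then obtain r where r: "simple_function M r" "\<And>u. u \<in> (\<Union>y\<in>Y. ?B y) \<Longrightarrow> norm (\<phi> u - r u) < d"
    by blast
  show thesis
    by (rule that[OF r(1)]) (rule r(2)[OF subsetD[OF Y(2)]])
qed

text \<open>A continuous function on the whole group may have an essentially nonseparable range. Cut
  off to a compact set, it is a uniform limit of simple functions.\<close>

lemma strongly_measurable_continuous_compact:
  fixes \<phi> :: "'a::t2_space \<Rightarrow> 'b::real_normed_vector"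
  assumes \<phi>: "continuous_on UNIV \<phi>" and C: "compact C"
    and M: "sets borel \<subseteq> sets M" "space M = UNIV"
  shows "strongly_measurable M (\<lambda>u. indicator C u *\<^sub>R \<phi> u)"
proof -
  have "\<exists>r. simple_function M r \<and> (\<forall>u\<in>C. norm (\<phi> u - r u) < inverse (real (Suc n)))" for n
    by (rule continuous_simple_approx[OF \<phi> C _ M, of "inverse (real (Suc n))"]) auto
  then obtain r where r: "\<And>n. simple_function M (r n)"
    "\<And>n u. u \<in> C \<Longrightarrow> norm (\<phi> u - r n u) < inverse (real (Suc n))" by metis
  have "C \<in> sets M" using C M by (auto intro: borel_closed compact_imp_closed)
  then have "simple_function M (\<lambda>u. indicator C u *\<^sub>R r n u)" for n
    by (intro simple_function_compose2[OF simple_function_indicator r(1)])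
  moreover have "(\<lambda>n. indicator C u *\<^sub>R r n u) \<longlonglongrightarrow> indicator C u *\<^sub>R \<phi> u" for u
  proof (cases "u \<in> C")
    case True
    have "(\<lambda>n. norm (r n u - \<phi> u)) \<longlonglongrightarrow> 0"
      by (rule tendsto_sandwich[OF _ _ tendsto_const LIMSEQ_inverse_real_of_nat])
         (use r(2)[OF True] in \<open>auto simp: norm_minus_commute less_imp_le\<close>)
    with True show ?thesis by (simp add: tendsto_norm_zero_iff LIM_zero_iff)
  qed simp
  ultimately show ?thesis unfolding strongly_measurable_def
    by (intro exI[of _ "\<lambda>n u. indicator C u *\<^sub>R r n u"]) auto
qed

section \<open>Tightness of integrable functions on the group\<close>

lemma haar_measure_space: "haar_measure \<mu> \<Longrightarrow> space \<mu> = UNIV"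
  using sets_eq_imp_space_eq[of \<mu> borel] by (simp add: haar_measure_def)

lemma haar_measure_borel_sets_completion: "haar_measure \<mu> \<Longrightarrow> sets borel \<subseteq> sets (completion \<mu>)"
  unfolding haar_measure_def by (metis sets_completionI_sets subsetI)

text \<open>A substitute for sigma-finiteness. An L^1 approximation of \<open>K\<close> by a simple
  function leaves a bounded function supported on a set of finite measure; outer regularity encloses
  that set in an open \<open>U\<close>, and inner regularity exhausts \<open>U\<close> by a compact
  \<open>C\<close>.\<close>

lemma haar_measure_tight:
  fixes \<mu> :: "'g::{topological_ab_group_add, t2_space} measure" and K :: "'g \<Rightarrow> 'b::real_normed_vector"
  assumes \<mu>: "haar_measure \<mu>"
    and K: "strongly_measurable (completion \<mu>) K" "(\<integral>\<^sup>+u. ennreal (norm (K u)) \<partial>completion \<mu>) < \<infinity>"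
    and e: "0 < (e::real)"
  obtains C where "compact C" "(\<integral>\<^sup>+u. ennreal (norm (K u)) * indicator (- C) u \<partial>completion \<mu>) \<le> ennreal e"
proof -
  have sets: "sets \<mu> = sets borel" using \<mu> by (auto simp: haar_measure_def)
  note space = haar_measure_space[OF \<mu>]
  from completion.strongly_measurable_L1_approx[OF K]
  obtain s where s: "\<And>n. Bochner_Integration.simple_bochner_integrable (completion \<mu>) (s n)"
    "(\<lambda>n::nat. \<integral>\<^sup>+x. ennreal (norm (K x - s n x)) \<partial>completion \<mu>) \<longlonglongrightarrow> 0" by blast
  have "eventually (\<lambda>n. (\<integral>\<^sup>+x. ennreal (norm (K x - s n x)) \<partial>completion \<mu>) < ennreal (e/2)) sequentially"
    by (intro order_tendstoD(2)[OF s(2)]) (use e in auto)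
  then obtain n where n: "(\<integral>\<^sup>+x. ennreal (norm (K x - s n x)) \<partial>completion \<mu>) < ennreal (e/2)"
    by (auto simp: eventually_sequentially)
  have sf: "simple_function (completion \<mu>) (s n)" and sfin: "emeasure (completion \<mu>) {u. s n u \<noteq> 0} \<noteq> \<infinity>"
    using s(1)[of n] by (auto simp: simple_bochner_integrable.simps space)
  have "finite (range (s n))" using sf by (simp add: simple_function_def space)
  then have "finite (range (\<lambda>u. norm (s n u)))" by (metis finite_imageI image_image)
  then have "bdd_above (range (\<lambda>u. norm (s n u)))" by (rule bdd_above_finite)
  then obtain b where b: "0 < b" "\<And>u. norm (s n u) \<le> b"
    unfolding bdd_above_def by (metis gt_ex less_le_trans less_imp_le max.strict_boundedE not_le order_trans rangeI)
  have "simple_function (completion \<mu>) (\<lambda>u. s n u \<noteq> 0)"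
    by (rule simple_function_compose1[OF sf])
  then have "{u. s n u \<noteq> 0} \<in> sets (completion \<mu>)"
    using simple_functionD(2)[of "completion \<mu>" "\<lambda>u. s n u \<noteq> 0" "{True}"] by (simp add: space vimage_def)
  \<comment> \<open>The support is measurable only for the completion, while outer regularity speaks
    of Borel sets; hence the passage to a Borel superset of equal measure.\<close>
  then obtain A where A': "A \<in> sets \<mu>" "{u. s n u \<noteq> 0} \<subseteq> A"
    "emeasure (completion \<mu>) {u. s n u \<noteq> 0} = emeasure \<mu> A" by (rule completion_upper)
  then have A: "A \<in> sets borel" "{u. s n u \<noteq> 0} \<subseteq> A" "emeasure \<mu> A < \<infinity>"
    using sfin sets by (simp_all only: less_top infinity_ennreal_def simp_thms)
  have "(INF U\<in>{U. open U \<and> A \<subseteq> U}. emeasure \<mu> U) < \<infinity>"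
    using A \<mu> by (auto simp: haar_measure_def)
  then obtain U where U: "open U" "A \<subseteq> U" "emeasure \<mu> U < \<infinity>"
    by (auto simp: INF_less_iff)
  have U_eq: "emeasure \<mu> U = (SUP C\<in>{C. compact C \<and> C \<subseteq> U}. emeasure \<mu> C)"
    using U \<mu> by (auto simp: haar_measure_def)
  \<comment> \<open>The tolerance is chosen so that a function bounded by \<open>b\<close>
    contributes at most \<open>e/2\<close> on \<open>U - C\<close>.\<close>
  have "\<exists>C\<in>{C. compact C \<and> C \<subseteq> U}. emeasure \<mu> U < emeasure \<mu> C + ennreal (e / (2*b))"
  proof (rule SUP_approx_ennreal[OF _ _ U_eq])
    show "{C. compact C \<and> C \<subseteq> U} \<noteq> {}" using compact_empty by blast
  qed (use e b U(3) in auto)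
  then obtain C where C: "compact C" "C \<subseteq> U" "emeasure \<mu> U < emeasure \<mu> C + ennreal (e / (2*b))" by blast
  have meas: "C \<in> sets \<mu>" "U \<in> sets \<mu>" using C U by (auto simp: sets intro: borel_closed compact_imp_closed)
  have "emeasure \<mu> C + emeasure \<mu> (U - C) = emeasure \<mu> U"
    using C meas by (subst plus_emeasure) (auto simp: Un_absorb1)
  with C(3) have UC: "emeasure \<mu> (U - C) \<le> ennreal (e / (2*b))"
    by (metis ennreal_add_left_cancel_less less_imp_le)
  have "(\<integral>\<^sup>+u. ennreal (norm (K u)) * indicator (- C) u \<partial>completion \<mu>)
      \<le> (\<integral>\<^sup>+u. ennreal (norm (K u - s n u)) + ennreal b * indicator (U - C) u \<partial>completion \<mu>)"
  proof (intro nn_integral_mono)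
    fix u
    have 1: "norm (K u) \<le> norm (K u - s n u) + b"
      using norm_triangle_sub[of "K u" "s n u"] b(2)[of u] by simp
    have 2: "norm (K u) = norm (K u - s n u)" if "u \<notin> U"
      using that U A by (metis (mono_tags) diff_zero mem_Collect_eq subsetD)
    show "ennreal (norm (K u)) * indicator (- C) u \<le> ennreal (norm (K u - s n u)) + ennreal b * indicator (U - C) u"
      using ennreal_leI[OF 1] 2 b(1) by (auto simp: ennreal_plus split: split_indicator)
  qed
  also have "\<dots> = (\<integral>\<^sup>+u. ennreal (norm (K u - s n u)) \<partial>completion \<mu>) + (\<integral>\<^sup>+u. ennreal b * indicator (U - C) u \<partial>completion \<mu>)"
    by (intro nn_integral_add completion.strongly_measurable_norm_diff_simple K s)
       (use meas in \<open>auto intro!: borel_measurable_times_ennreal borel_measurable_indicator\<close>)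
  also have "(\<integral>\<^sup>+u. ennreal b * indicator (U - C) u \<partial>completion \<mu>) = ennreal b * emeasure \<mu> (U - C)"
    using meas by (simp add: nn_integral_cmult_indicator)
  also have "\<dots> \<le> ennreal b * ennreal (e / (2*b))"
    by (intro mult_left_mono UC) auto
  also have "\<dots> = ennreal (e/2)"
    using b e by (simp add: ennreal_mult[symmetric])
  finally have "(\<integral>\<^sup>+u. ennreal (norm (K u)) * indicator (- C) u \<partial>completion \<mu>) \<le> ennreal (e/2) + ennreal (e/2)"
    using n by (meson add_mono less_imp_le order_refl order_trans)
  also have "\<dots> = ennreal e" using e by (simp flip: ennreal_plus)
  finally show thesis using that C(1) by blast
qed

text \<open>By tightness \<open>K\<close> vanishes almost everywhere off a countable union of
  compact sets, and on compact sets \<open>\<phi>\<close> is uniformly approximable by simple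
  functions. So the product is strongly measurable even if \<open>\<phi>\<close> is not.\<close>

lemma strongly_measurable_apply_continuous:
  fixes \<mu> :: "'g::{topological_ab_group_add, t2_space} measure"
    and K :: "'g \<Rightarrow> ('x::real_normed_vector \<Rightarrow>\<^sub>L 'y::real_normed_vector)"
  assumes \<mu>: "haar_measure \<mu>"
    and K: "strongly_measurable (completion \<mu>) K" "(\<integral>\<^sup>+u. ennreal (norm (K u)) \<partial>completion \<mu>) < \<infinity>"
    and \<phi>: "continuous_on UNIV \<phi>"
  shows "strongly_measurable (completion \<mu>) (\<lambda>u. blinfun_apply (K u) (\<phi> u))"
proof -
  note sets = haar_measure_borel_sets_completion[OF \<mu>]
  note space = haar_measure_space[OF \<mu>]
  let ?d = "\<lambda>n. inverse (real (Suc n))"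
  obtain s where s: "\<And>n. simple_function (completion \<mu>) (s n)"
    "AE u in completion \<mu>. (\<lambda>n::nat. s n u) \<longlonglongrightarrow> K u"
    using K(1) unfolding strongly_measurable_def by blast
  have "\<exists>C. compact C \<and> (\<integral>\<^sup>+u. ennreal (norm (K u)) * indicator (- C) u \<partial>completion \<mu>) \<le> ennreal (?d n)" for n
    by (rule haar_measure_tight[OF \<mu> K, of "?d n"]) auto
  then obtain D where D: "\<And>n. compact (D n)"
    "\<And>n. (\<integral>\<^sup>+u. ennreal (norm (K u)) * indicator (- D n) u \<partial>completion \<mu>) \<le> ennreal (?d n)" by metis
  \<comment> \<open>Finite unions make the sets increase, so a point of \<open>C m\<close> stays in
    all later ones.\<close>
  define C where "C n = (\<Union>i\<le>n. D i)" for n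
  have C: "compact (C n)" for n unfolding C_def by (intro compact_UN D) auto
  have C_meas: "C n \<in> sets (completion \<mu>)" for n
    by (rule subsetD[OF sets]) (intro borel_closed compact_imp_closed C)
  have "\<exists>r. simple_function (completion \<mu>) r \<and> (\<forall>u\<in>C n. norm (\<phi> u - r u) < ?d n)" for n
    by (rule continuous_simple_approx[OF \<phi> C, of "?d n" "completion \<mu>" n]) (use sets in \<open>auto simp: space\<close>)
  then obtain r where r: "\<And>n. simple_function (completion \<mu>) (r n)"
    "\<And>n u. u \<in> C n \<Longrightarrow> norm (\<phi> u - r n u) < ?d n" by metis
  define E where "E = - (\<Union>n. C n)"
  have E: "E \<in> sets (completion \<mu>)"
    using C_meas unfolding E_def by (metis Compl_eq_Diff_UNIV space space_completion sets.compl_sets sets.countable_UN UNIV_I image_subset_iff)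
  note [measurable] = completion.strongly_measurable_norm[OF K(1)] E
  have "(\<integral>\<^sup>+u. ennreal (norm (K u)) * indicator E u \<partial>completion \<mu>) \<le> ennreal (?d n)" for n
    by (rule order_trans[OF nn_integral_mono D(2)]) (auto simp: E_def C_def split: split_indicator)
  moreover have "(\<lambda>n. ennreal (?d n)) \<longlonglongrightarrow> ennreal 0"
    by (intro tendsto_ennrealI LIMSEQ_inverse_real_of_nat)
  ultimately have "(\<integral>\<^sup>+u. ennreal (norm (K u)) * indicator E u \<partial>completion \<mu>) \<le> ennreal 0"
    by (intro LIMSEQ_le_const) auto
  then have "(\<integral>\<^sup>+u. ennreal (norm (K u)) * indicator E u \<partial>completion \<mu>) = 0" by simp
  then have AE0: "AE u in completion \<mu>. ennreal (norm (K u)) * indicator E u = 0"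
    by (subst (asm) nn_integral_0_iff_AE) auto
  \<comment> \<open>The indicator makes the approximants vanish on \<open>E\<close>, where
    \<open>K\<close> is zero almost everywhere; off \<open>E\<close> it is eventually 1.\<close>
  have "simple_function (completion \<mu>) (\<lambda>u. indicat_real (C n) u *\<^sub>R blinfun_apply (s n u) (r n u))" for n
    by (rule simple_function_compose2[OF simple_function_indicator[OF C_meas]
          simple_function_compose2[OF s(1) r(1), where h="blinfun_apply"], where h="scaleR"])
  moreover have "AE u in completion \<mu>. (\<lambda>n. indicat_real (C n) u *\<^sub>R blinfun_apply (s n u) (r n u))
      \<longlonglongrightarrow> blinfun_apply (K u) (\<phi> u)"
    using s(2) AE0
  proof eventually_elim
    case (elim u)
    show ?case
    proof (cases "u \<in> E")
      case True
      then have "K u = 0" using elim(2) by simp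
      moreover have "u \<notin> C n" for n using True by (auto simp: E_def)
      ultimately show ?thesis by simp
    next
      case False
      then obtain m where m: "u \<in> C m" by (auto simp: E_def)
      have mC: "u \<in> C n" if "n \<ge> m" for n using m that by (force simp: C_def)
      have "(\<lambda>n. norm (r n u - \<phi> u)) \<longlonglongrightarrow> 0"
      proof (rule tendsto_sandwich[OF _ _ tendsto_const LIMSEQ_inverse_real_of_nat])
        show "eventually (\<lambda>n. norm (r n u - \<phi> u) \<le> ?d n) sequentially"
          using eventually_ge_at_top[of m]
          by eventually_elim (use r(2)[OF mC] in \<open>auto simp: norm_minus_commute less_imp_le\<close>)
      qed auto
      then have "(\<lambda>n. r n u) \<longlonglongrightarrow> \<phi> u" by (simp add: tendsto_norm_zero_iff LIM_zero_iff)
      then have "(\<lambda>n. blinfun_apply (s n u) (r n u)) \<longlonglongrightarrow> blinfun_apply (K u) (\<phi> u)"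
        by (intro tendsto_intros elim)
      moreover have "eventually (\<lambda>n. blinfun_apply (s n u) (r n u)
          = indicat_real (C n) u *\<^sub>R blinfun_apply (s n u) (r n u)) sequentially"
        using eventually_ge_at_top[of m] by eventually_elim (use mC in auto)
      ultimately show ?thesis by (rule Lim_transform_eventually)
    qed
  qed
  ultimately show ?thesis unfolding strongly_measurable_def
    by (intro exI[of _ "\<lambda>n u. indicat_real (C n) u *\<^sub>R blinfun_apply (s n u) (r n u)"]) auto
qed

section \<open>Transference\<close>

lemma ennreal_le_enn2real:
  assumes "ennreal x \<le> y" "y < \<infinity>"
  shows "x \<le> enn2real y"
  using assms by (cases y) (auto simp: ennreal_le_iff2)

lemma Lp_norm_le_1:
  assumes p: "1 \<le> (p::real)" and A: "A \<in> sets M"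
    and le: "\<And>x. norm (f x) \<le> b * indicator A x"
    and b: "0 \<le> b" and small: "ennreal (b powr p) * emeasure M A \<le> 1"
  shows "Lp_norm M p f \<le> 1"
proof -
  let ?t = "\<integral>\<^sup>+x. ennreal (norm (f x) powr p) \<partial>M"
  have "?t \<le> (\<integral>\<^sup>+x. ennreal (b powr p) * indicator A x \<partial>M)"
  proof (intro nn_integral_mono)
    fix x
    show "ennreal (norm (f x) powr p) \<le> ennreal (b powr p) * indicator A x"
      using le[of x] p b by (cases "x \<in> A") (auto intro!: ennreal_leI powr_mono2)
  qed
  also have "\<dots> = ennreal (b powr p) * emeasure M A" using A by (rule nn_integral_cmult_indicator)
  finally have t: "?t \<le> 1" using small by (rule order_trans)
  then have "enn2real ?t \<le> 1" by (simp add: enn2real_leI)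
  then have "enn2real ?t powr (1/p) \<le> 1" using p by (intro powr_le1) auto
  moreover have "?t \<noteq> \<infinity>" using t by (auto simp: top_unique)
  ultimately show ?thesis by (simp add: Lp_norm_def)
qed

lemma Lp_norm_ge:
  assumes p: "1 \<le> (p::real)" and V: "A \<in> sets M" "emeasure M A < \<infinity>"
    and le: "\<And>x. x \<in> A \<Longrightarrow> b \<le> norm (f x)" and b: "0 \<le> b"
  shows "ennreal (b * measure M A powr (1/p)) \<le> Lp_norm M p f"
proof -
  let ?t = "\<integral>\<^sup>+x. ennreal (norm (f x) powr p) \<partial>M"
  have "ennreal (b powr p) * emeasure M A = (\<integral>\<^sup>+x. ennreal (b powr p) * indicator A x \<partial>M)"
    using V by (simp add: nn_integral_cmult_indicator)
  \<comment> \<open>\<open>nn_integral\<close> is monotone on arbitrary functions, so the estimate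
    applies to a convolution whose measurability has not been established.\<close>
  also have "\<dots> \<le> ?t"
    using le p b by (intro nn_integral_mono) (auto intro!: ennreal_leI powr_mono2 split: split_indicator)
  finally have t: "ennreal (b powr p * measure M A) \<le> ?t"
    using V by (simp add: ennreal_mult emeasure_eq_ennreal_measure)
  show ?thesis
  proof (cases "?t = \<infinity>")
    case True
    then show ?thesis by (simp add: Lp_norm_def)
  next
    case False
    then have "b powr p * measure M A \<le> enn2real ?t"
      using t by (intro ennreal_le_enn2real) (auto simp: less_top)
    then have "(b powr p * measure M A) powr (1/p) \<le> enn2real ?t powr (1/p)"
      using p by (intro powr_mono2) auto
    moreover have "(b powr p * measure M A) powr (1/p) = b * measure M A powr (1/p)"
      using p b by (simp add: powr_mult powr_powr)
    ultimately show ?thesis using False by (simp add: Lp_norm_def ennreal_leI)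
  qed
qed

section \<open>The transference operator: existence, linearity, boundedness\<close>

locale transference =
  fixes \<mu> :: "'g::{topological_ab_group_add, t2_space} measure"
    and K :: "'g \<Rightarrow> ('x::banach \<Rightarrow>\<^sub>L 'y::banach)"
    and R :: "'g \<Rightarrow> ('x \<Rightarrow>\<^sub>L 'x)"
    and R' :: "'g \<Rightarrow> ('y \<Rightarrow>\<^sub>L 'y)"
    and c\<^sub>1 c\<^sub>2 :: real
  assumes locally_compact: "locally_compact_space (euclidean :: 'g topology)"
    and haar: "haar_measure \<mu>"
    and kernel: "K \<in> Lp_space (completion \<mu>) 1"
    and rep: "strongly_continuous_representation R"
    and rep': "strongly_continuous_representation R'"
    and R_bound: "\<And>u. norm (R u) \<le> c\<^sub>1"
    and R'_bound: "\<And>u. norm (R' u) \<le> c\<^sub>2"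
    and intertwine: "\<And>u v x. blinfun_apply (K u) (blinfun_apply (R v) x)
                 = blinfun_apply (R' v) (blinfun_apply (K u) x)"
begin

abbreviation "M \<equiv> completion \<mu>"

text \<open>The integrand of \<open>transference_op\<close>, called \<open>g\<close> in the
  overview.\<close>

definition orbit_kernel :: "'x \<Rightarrow> 'g \<Rightarrow> 'y" where
  "orbit_kernel x u = blinfun_apply (K u) (blinfun_apply (R (- u)) x)"

lemma c1_nonneg: "0 \<le> c\<^sub>1" by (rule order_trans[OF norm_ge_zero R_bound[of 0]])
lemma c2_nonneg: "0 \<le> c\<^sub>2" by (rule order_trans[OF norm_ge_zero R'_bound[of 0]])

lemma R_le: "norm (blinfun_apply (R u) x) \<le> c\<^sub>1 * norm x"
  using norm_blinfun[of "R u" x] R_bound[of u] by (meson mult_right_mono norm_ge_zero order_trans)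
lemma R'_le: "norm (blinfun_apply (R' u) y) \<le> c\<^sub>2 * norm y"
  using norm_blinfun[of "R' u" y] R'_bound[of u] by (meson mult_right_mono norm_ge_zero order_trans)

lemma R_add: "blinfun_apply (R (u + v)) x = blinfun_apply (R u) (blinfun_apply (R v) x)"
  using rep by (simp add: strongly_continuous_representation_def)
lemma R'_add: "blinfun_apply (R' (u + v)) x = blinfun_apply (R' u) (blinfun_apply (R' v) x)"
  using rep' by (simp add: strongly_continuous_representation_def)
lemma R_0: "blinfun_apply (R 0) x = x"
  using rep by (simp add: strongly_continuous_representation_def)
lemma R'_0: "blinfun_apply (R' 0) x = x"
  using rep' by (simp add: strongly_continuous_representation_def)

text \<open>The representation sends 0 to the identity, which has norm 1 on a nonzero space. This
  later permits division by the constants.\<close>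

lemma c1_ge_1: "(x::'x) \<noteq> 0 \<Longrightarrow> 1 \<le> c\<^sub>1"
  using R_le[of 0 x] by (simp add: R_0)
lemma c2_ge_1: "(y::'y) \<noteq> 0 \<Longrightarrow> 1 \<le> c\<^sub>2"
  using R'_le[of 0 y] by (simp add: R'_0)

lemma R_continuous: "continuous_on UNIV (\<lambda>u. blinfun_apply (R u) x)"
  using rep by (simp add: strongly_continuous_representation_def)

lemma kernel_measurable: "strongly_measurable M K"
  using kernel by (simp add: Lp_space_def)

lemma kernel_integrable: "(\<integral>\<^sup>+u. ennreal (norm (K u)) \<partial>M) < \<infinity>"
proof -
  have "(\<integral>\<^sup>+u. ennreal (norm (K u) powr 1) \<partial>M) \<noteq> \<infinity>"
    using kernel by (auto simp: Lp_space_def Lp_norm_def Let_def split: if_splits)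
  then show ?thesis by (simp add: less_top)
qed

lemma orbit_kernel_measurable: "strongly_measurable M (orbit_kernel x)"
  unfolding orbit_kernel_def[abs_def]
  by (intro strongly_measurable_apply_continuous haar kernel_measurable kernel_integrable
      continuous_on_compose2[OF R_continuous]) (auto intro!: continuous_intros)

lemma norm_orbit_kernel_le: "norm (orbit_kernel x u) \<le> c\<^sub>1 * norm x * norm (K u)"
proof -
  have "norm (orbit_kernel x u) \<le> norm (K u) * norm (blinfun_apply (R (- u)) x)"
    unfolding orbit_kernel_def by (rule norm_blinfun)
  also have "\<dots> \<le> norm (K u) * (c\<^sub>1 * norm x)" by (intro mult_left_mono R_le) auto
  finally show ?thesis by (simp add: mult.commute)
qed

lemma nn_integral_orbit_kernel_le:
  "(\<integral>\<^sup>+u. ennreal (norm (orbit_kernel x u)) \<partial>M) \<le> ennreal (c\<^sub>1 * norm x) * (\<integral>\<^sup>+u. ennreal (norm (K u)) \<partial>M)"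
proof -
  note [measurable] = completion.strongly_measurable_norm[OF kernel_measurable]
  have "(\<integral>\<^sup>+u. ennreal (norm (orbit_kernel x u)) \<partial>M) \<le> (\<integral>\<^sup>+u. ennreal (c\<^sub>1 * norm x) * ennreal (norm (K u)) \<partial>M)"
    using c1_nonneg by (intro nn_integral_mono) (auto simp: ennreal_mult[symmetric] intro!: ennreal_leI norm_orbit_kernel_le)
  also have "\<dots> = ennreal (c\<^sub>1 * norm x) * (\<integral>\<^sup>+u. ennreal (norm (K u)) \<partial>M)"
    by (intro nn_integral_cmult) measurable
  finally show ?thesis .
qed

lemma nn_integral_orbit_kernel_finite: "(\<integral>\<^sup>+u. ennreal (norm (orbit_kernel x u)) \<partial>M) < \<infinity>"
  by (rule le_less_trans[OF nn_integral_orbit_kernel_le])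
     (use kernel_integrable in \<open>auto simp: ennreal_mult_less_top\<close>)

lemma orbit_kernel_integrable: "bochner_integrable M (orbit_kernel x)"
  by (intro completion.bochner_integrableI orbit_kernel_measurable nn_integral_orbit_kernel_finite)

abbreviation "T \<equiv> transference_op \<mu> K R"

lemma T_has_integral: "bochner_has_integral M (orbit_kernel x) (T x)"
  using completion.bochner_has_integral_bochner_integral[OF orbit_kernel_integrable]
  by (simp add: transference_op_def orbit_kernel_def[abs_def])

lemma bounded_linear_T: "bounded_linear T"
proof (rule bounded_linear_intro)
  fix x y
  have "(\<lambda>u. orbit_kernel x u + orbit_kernel y u) = orbit_kernel (x + y)"
    by (simp add: orbit_kernel_def fun_eq_iff blinfun.add_right)
  then show "T (x + y) = T x + T y"
    using completion.bochner_has_integral_add[OF T_has_integral T_has_integral, of x y]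
    by (auto intro: completion.bochner_has_integral_unique T_has_integral)
next
  fix r :: real and x
  have "(\<lambda>u. r *\<^sub>R orbit_kernel x u) = orbit_kernel (r *\<^sub>R x)"
    by (simp add: orbit_kernel_def fun_eq_iff blinfun.scaleR_right)
  then show "T (r *\<^sub>R x) = r *\<^sub>R T x"
    using completion.bochner_has_integral_linear[OF T_has_integral[of x] bounded_linear_scaleR_right[of r]]
    by (auto intro: completion.bochner_has_integral_unique T_has_integral)
next
  fix x
  let ?k = "enn2real (\<integral>\<^sup>+u. ennreal (norm (K u)) \<partial>M)"
  have "ennreal (norm (T x)) \<le> ennreal (c\<^sub>1 * norm x) * (\<integral>\<^sup>+u. ennreal (norm (K u)) \<partial>M)"
    by (rule order_trans[OF completion.bochner_has_integral_norm_le[OF T_has_integral] nn_integral_orbit_kernel_le])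
  also have "\<dots> = ennreal (c\<^sub>1 * norm x * ?k)"
    using kernel_integrable c1_nonneg by (simp add: ennreal_mult less_top)
  finally show "norm (T x) \<le> norm x * (c\<^sub>1 * ?k)"
    using c1_nonneg by (simp add: ennreal_le_iff mult_ac)
qed

section \<open>Convolution with truncated orbits\<close>

definition truncated_orbit :: "real \<Rightarrow> 'g set \<Rightarrow> 'x \<Rightarrow> 'g \<Rightarrow> 'x" where
  "truncated_orbit l W x w = indicator W w *\<^sub>R blinfun_apply (R w) (l *\<^sub>R x)"

lemma truncated_orbit_measurable: "compact W \<Longrightarrow> strongly_measurable M (truncated_orbit l W x)"
  unfolding truncated_orbit_def[abs_def]
  by (intro strongly_measurable_continuous_compact R_continuous haar_measure_borel_sets_completion haar)
     (simp_all add: haar_measure_space[OF haar])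

lemma norm_truncated_orbit_le:
  "0 \<le> l \<Longrightarrow> norm (truncated_orbit l W x w) \<le> (l * c\<^sub>1 * norm x) * indicator W w"
  using R_le[of w "l *\<^sub>R x"] by (auto simp: truncated_orbit_def mult_ac split: split_indicator)

text \<open>Split \<open>R (v - u)\<close> into \<open>R v\<close> and \<open>R (- u)\<close> and
  move \<open>R v\<close> through \<open>K u\<close> by intertwining. The resulting factor
  \<open>R' v\<close> is independent of \<open>u\<close> and can leave the integral.\<close>

lemma kernel_truncated_orbit:
  "blinfun_apply (K u) (truncated_orbit l W x (v - u))
     = blinfun_apply (R' v) (l *\<^sub>R (indicator {u. v - u \<in> W} u *\<^sub>R orbit_kernel x u))"
  using R_add[of v "- u" x]
  by (simp add: truncated_orbit_def orbit_kernel_def intertwine blinfun.scaleR_right split: split_indicator)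

text \<open>The convolution at \<open>v\<close> is \<open>R' v\<close> applied to \<open>l\<close>
  times the integral of the orbit kernel over \<open>v - W\<close>. As \<open>C\<close> lies in that
  set, this integral differs from \<open>T x\<close> by at most \<open>e\<close>.\<close>

lemma convolution_truncated_orbit_ge:
  assumes W: "compact W" and CW: "\<And>u. u \<in> C \<Longrightarrow> v - u \<in> W"
    and C: "(\<integral>\<^sup>+u. ennreal (norm (orbit_kernel x u)) * indicator (- C) u \<partial>M) \<le> ennreal e"
    and e: "0 \<le> e" and l: "0 \<le> l"
  shows "l * (norm (T x) - e) \<le> c\<^sub>2 * norm (convolution \<mu> K (truncated_orbit l W x) v)"
proof -
  define E where "E = {u. v - u \<in> W}"
  have "closed E"
    using closed_vimage[OF compact_imp_closed[OF W], of "\<lambda>u. v - u"]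
    by (simp add: E_def vimage_def continuous_on_diff)
  then have "E \<in> sets borel" "- E \<in> sets borel" by auto
  then have E: "E \<in> sets M" "- E \<in> sets M"
    using haar_measure_borel_sets_completion[OF haar] by auto
  have int: "bochner_integrable M (\<lambda>u. indicat_real S u *\<^sub>R orbit_kernel x u)" if "S \<in> sets M" for S
  proof (rule completion.bochner_integrableI)
    show "strongly_measurable M (\<lambda>u. indicat_real S u *\<^sub>R orbit_kernel x u)"
      by (intro completion.strongly_measurable_indicator_scaleR orbit_kernel_measurable that)
    show "(\<integral>\<^sup>+u. ennreal (norm (indicat_real S u *\<^sub>R orbit_kernel x u)) \<partial>M) < \<infinity>"
      by (rule le_less_trans[OF nn_integral_mono nn_integral_orbit_kernel_finite[of x]])
         (auto split: split_indicator)
  qed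
  obtain J J' where J: "bochner_has_integral M (\<lambda>u. indicat_real E u *\<^sub>R orbit_kernel x u) J"
    and J': "bochner_has_integral M (\<lambda>u. indicat_real (- E) u *\<^sub>R orbit_kernel x u) J'"
    using int[OF E(1)] int[OF E(2)] unfolding bochner_integrable_def by blast
  have "(\<lambda>u. indicat_real E u *\<^sub>R orbit_kernel x u + indicat_real (- E) u *\<^sub>R orbit_kernel x u) = orbit_kernel x"
    by (auto split: split_indicator)
  with completion.bochner_has_integral_add[OF J J'] have T: "T x = J + J'"
    using completion.bochner_has_integral_unique T_has_integral by metis
  have "ennreal (norm J') \<le> (\<integral>\<^sup>+u. ennreal (norm (indicat_real (- E) u *\<^sub>R orbit_kernel x u)) \<partial>M)"
    by (rule completion.bochner_has_integral_norm_le[OF J'])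
  also have "\<dots> \<le> (\<integral>\<^sup>+u. ennreal (norm (orbit_kernel x u)) * indicator (- C) u \<partial>M)"
    using CW by (intro nn_integral_mono) (auto simp: E_def split: split_indicator)
  also note C
  finally have "norm J' \<le> e" using e by simp
  then have "norm (T x) - e \<le> norm J"
    using norm_triangle_ineq[of J J'] T by simp
  then have "l * (norm (T x) - e) \<le> l * norm J" using l by (rule mult_left_mono)
  \<comment> \<open>Undoing \<open>R' v\<close> by \<open>R' (- v)\<close> is what costs the factor
    \<open>c\<^sub>2\<close>.\<close>
  also have "\<dots> = norm (blinfun_apply (R' (- v)) (blinfun_apply (R' v) (l *\<^sub>R J)))"
    using R'_add[of "- v" v "l *\<^sub>R J"] l by (simp add: R'_0)
  also have "blinfun_apply (R' v) (l *\<^sub>R J) = convolution \<mu> K (truncated_orbit l W x) v"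
  proof -
    have "bounded_linear (\<lambda>y. blinfun_apply (R' v) (l *\<^sub>R y))"
      by (intro bounded_linear_compose[OF blinfun.bounded_linear_right] bounded_linear_scaleR_right)
    from completion.bochner_integral_eq[OF completion.bochner_has_integral_linear[OF J this]]
    show ?thesis unfolding convolution_def kernel_truncated_orbit E_def by simp
  qed
  also have "norm (blinfun_apply (R' (- v)) (convolution \<mu> K (truncated_orbit l W x) v))
      \<le> c\<^sub>2 * norm (convolution \<mu> K (truncated_orbit l W x) v)" by (rule R'_le)
  finally show ?thesis .
qed

text \<open>The operator norm of the convolution is tested on a truncated orbit scaled into the unit
  ball. The same \<open>e\<close> serves as tail error and as excess in the ratio of
  measures.\<close>

lemma norm_T_approx:
  assumes x: "x \<noteq> 0" and c2: "1 \<le> c\<^sub>2" and p: "1 \<le> p" and fin: "conv_op_norm \<mu> p K < \<infinity>"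
    and e: "0 < e"
  shows "norm (T x) - e \<le> (1 + e) * (c\<^sub>1 * c\<^sub>2 * enn2real (conv_op_norm \<mu> p K) * norm x)"
proof (cases "norm (T x) \<le> e")
  case True
  moreover have "0 \<le> (1 + e) * (c\<^sub>1 * c\<^sub>2 * enn2real (conv_op_norm \<mu> p K) * norm x)"
    using e c1_nonneg c2_nonneg by (intro mult_nonneg_nonneg) auto
  ultimately show ?thesis by linarith
next
  \<comment> \<open>Here \<open>norm (T x) - e\<close> is positive, as the lower bound in
    \<open>Lp_norm_ge\<close> has to be nonnegative.\<close>
  case False
  have c1: "1 \<le> c\<^sub>1" using x by (rule c1_ge_1)
  obtain C where C: "compact C"
    "(\<integral>\<^sup>+u. ennreal (norm (orbit_kernel x u)) * indicator (- C) u \<partial>M) \<le> ennreal e"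
    using haar_measure_tight[OF haar orbit_kernel_measurable nn_integral_orbit_kernel_finite e] .
  obtain V W where VW: "compact V" "compact W" "emeasure \<mu> V > 0"
    "emeasure \<mu> W \<le> ennreal (1 + e) * emeasure \<mu> V" "\<And>v u. v \<in> V \<Longrightarrow> u \<in> C \<Longrightarrow> v - u \<in> W"
    by (rule haar_measure_folner[OF locally_compact haar C(1), of "1 + e"]) (use e in auto)
  have sets: "V \<in> sets \<mu>" "W \<in> sets \<mu>"
    using VW haar by (auto simp: haar_measure_def intro!: borel_closed compact_imp_closed)
  have finV: "emeasure \<mu> V < \<infinity>" using VW haar by (auto simp: haar_measure_def)
  define m where "m = measure \<mu> V"
  have emV: "emeasure \<mu> V = ennreal m" using finV by (simp add: m_def emeasure_eq_ennreal_measure)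
  have m: "0 < m" using VW(3) emV by simp
  \<comment> \<open>This makes \<open>(l * c\<^sub>1 * norm x) powr p\<close> the reciprocal of
    \<open>(1 + e) * m\<close>, an upper bound for the measure of \<open>W\<close>, so the truncated
    orbit has L^p norm at most 1.\<close>
  define l where "l = 1 / (c\<^sub>1 * norm x * ((1 + e) * m) powr (1/p))"
  have l: "0 < l" using c1 x e m by (simp add: l_def)
  let ?f = "truncated_orbit l W x"
  have "l * c\<^sub>1 * norm x = ((1 + e) * m) powr (- (1/p))"
    using c1 x by (simp add: l_def powr_minus_divide)
  then have "(l * c\<^sub>1 * norm x) powr p = ((1 + e) * m) powr (- (1/p) * p)"
    by (simp only: powr_powr)
  then have "(l * c\<^sub>1 * norm x) powr p = 1 / ((1 + e) * m)"
    using p e m by (simp add: powr_minus_divide)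
  moreover have "ennreal (1 / ((1 + e) * m)) * emeasure \<mu> W \<le> ennreal (1 / ((1 + e) * m)) * (ennreal (1 + e) * ennreal m)"
    using VW(4) emV by (intro mult_left_mono) auto
  moreover have "ennreal (1 / ((1 + e) * m)) * (ennreal (1 + e) * ennreal m) = 1"
    using e m by (simp add: ennreal_mult[symmetric] del: ennreal_plus)
  ultimately have small: "ennreal ((l * c\<^sub>1 * norm x) powr p) * emeasure M W \<le> 1"
    using sets by simp
  have "Lp_norm M p ?f \<le> 1"
    by (rule Lp_norm_le_1[OF p _ norm_truncated_orbit_le _ small]) (use sets l c1 in auto)
  then have "?f \<in> {f \<in> Lp_space M p. Lp_norm M p f \<le> 1}"
    using truncated_orbit_measurable[OF VW(2)] by (auto simp: Lp_space_def intro: le_less_trans)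
  then have "Lp_norm M p (convolution \<mu> K ?f) \<le> conv_op_norm \<mu> p K"
    unfolding conv_op_norm_def by (rule SUP_upper)
  moreover have "ennreal (l * (norm (T x) - e) / c\<^sub>2 * measure M V powr (1/p)) \<le> Lp_norm M p (convolution \<mu> K ?f)"
  proof (rule Lp_norm_ge[OF p])
    fix v assume "v \<in> V"
    from convolution_truncated_orbit_ge[OF VW(2) VW(5)[OF this] C(2), of l] e l c2
    show "l * (norm (T x) - e) / c\<^sub>2 \<le> norm (convolution \<mu> K ?f v)"
      by (simp add: divide_le_eq mult.commute)
  qed (use sets finV False c2 l in auto)
  ultimately have "ennreal (l * (norm (T x) - e) / c\<^sub>2 * m powr (1/p)) \<le> conv_op_norm \<mu> p K"
    using sets by (simp add: m_def)
  then have N: "l * (norm (T x) - e) / c\<^sub>2 * m powr (1/p) \<le> enn2real (conv_op_norm \<mu> p K)"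
    using fin by (intro ennreal_le_enn2real)
  have "norm (T x) - e \<le> c\<^sub>1 * c\<^sub>2 * norm x * (1 + e) powr (1/p) * enn2real (conv_op_norm \<mu> p K)"
  proof -
    let ?b = "c\<^sub>1 * c\<^sub>2 * norm x * (1 + e) powr (1/p)"
    have "l = 1 / (c\<^sub>1 * norm x * ((1 + e) powr (1/p) * m powr (1/p)))"
      using e m by (simp add: l_def powr_mult)
    then have "l * (norm (T x) - e) / c\<^sub>2 * m powr (1/p) = (norm (T x) - e) / ?b"
      using m by simp
    moreover have "0 < ?b" using c1 c2 x e by simp
    ultimately show ?thesis using N by (simp add: pos_divide_le_eq mult_ac)
  qed
  \<comment> \<open>Since \<open>1/p\<close> is at most 1, the factor
    \<open>(1 + e) powr (1/p)\<close> is at most \<open>1 + e\<close>, a bound free of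
    \<open>p\<close>.\<close>
  also have "\<dots> \<le> c\<^sub>1 * c\<^sub>2 * norm x * (1 + e) * enn2real (conv_op_norm \<mu> p K)"
    using powr_mono[of "1/p" 1 "1 + e"] p e c1 c2 by (intro mult_right_mono mult_left_mono) auto
  finally show ?thesis by (simp add: mult_ac)
qed

lemma norm_T_le:
  assumes x: "x \<noteq> 0" and c2: "1 \<le> c\<^sub>2" and p: "1 \<le> p" and fin: "conv_op_norm \<mu> p K < \<infinity>"
  shows "norm (T x) \<le> c\<^sub>1 * c\<^sub>2 * enn2real (conv_op_norm \<mu> p K) * norm x"
proof -
  define B where "B = c\<^sub>1 * c\<^sub>2 * enn2real (conv_op_norm \<mu> p K) * norm x"
  have B: "0 \<le> B" unfolding B_def using c1_nonneg c2_nonneg by simp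
  have "norm (T x) \<le> B + d" if "0 < d" for d
  proof -
    \<comment> \<open>With \<open>e = d / (1 + B)\<close> the total error \<open>e + e * B\<close>
      is exactly \<open>d\<close>.\<close>
    have "norm (T x) - d / (1 + B) \<le> (1 + d / (1 + B)) * B"
      unfolding B_def by (rule norm_T_approx[OF assms]) (use that B in \<open>simp add: B_def\<close>)
    moreover have "d / (1 + B) + d / (1 + B) * B = d / (1 + B) * (1 + B)"
      by (simp add: distrib_left)
    moreover have "\<dots> = d" using B by simp
    ultimately show ?thesis by (simp add: algebra_simps)
  qed
  then show ?thesis unfolding B_def[symmetric] by (rule field_le_epsilon)
qed

lemma onorm_T_le:
  assumes p: "1 \<le> p"
  shows "ennreal (onorm T) \<le> ennreal (c\<^sub>1 * c\<^sub>2) * conv_op_norm \<mu> p K"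
proof (cases "\<exists>x. T x \<noteq> 0")
  case False
  then have "T = (\<lambda>_. 0)" by auto
  then show ?thesis by (simp add: onorm_zero)
next
  case True
  then obtain x where "T x \<noteq> 0" by blast
  then have c2: "1 \<le> c\<^sub>2" and "x \<noteq> 0"
    using c2_ge_1 linear_0[OF bounded_linear.linear[OF bounded_linear_T]] by auto
  then have c1: "1 \<le> c\<^sub>1" using c1_ge_1 by blast
  show ?thesis
  proof (cases "conv_op_norm \<mu> p K = \<infinity>")
    case True
    \<comment> \<open>In \<open>ennreal\<close> zero times infinity is zero, so the bound is trivial
      for an infinite norm only once the constants are known to be positive; a nonzero value
      \<open>T x\<close> guarantees this.\<close>
    have "0 < c\<^sub>1 * c\<^sub>2" using c1 c2 by simp
    then have "ennreal (c\<^sub>1 * c\<^sub>2) \<noteq> 0" by (simp add: ennreal_eq_0_iff)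
    then show ?thesis using True by (simp add: ennreal_mult_eq_top_iff top_unique ennreal_mult_top)
  next
    case False
    then have fin: "conv_op_norm \<mu> p K < \<infinity>" by (simp add: less_top)
    have "onorm T \<le> c\<^sub>1 * c\<^sub>2 * enn2real (conv_op_norm \<mu> p K)"
    proof (rule onorm_bound)
      fix x show "norm (T x) \<le> c\<^sub>1 * c\<^sub>2 * enn2real (conv_op_norm \<mu> p K) * norm x"
        using norm_T_le[OF _ c2 p fin, of x] linear_0[OF bounded_linear.linear[OF bounded_linear_T]]
        by (cases "x = 0") auto
    qed (use c1 c2 in auto)
    then have "ennreal (onorm T) \<le> ennreal (c\<^sub>1 * c\<^sub>2 * enn2real (conv_op_norm \<mu> p K))"
      by (rule ennreal_leI)
    also have "\<dots> = ennreal (c\<^sub>1 * c\<^sub>2) * conv_op_norm \<mu> p K"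
      using fin c1 c2 by (simp add: ennreal_mult)
    finally show ?thesis .
  qed
qed

end

theorem theorem1p1:
  fixes \<mu> :: "'g::{topological_ab_group_add, t2_space} measure"
    and K :: "'g \<Rightarrow> ('x::banach \<Rightarrow>\<^sub>L 'y::banach)"
    and R :: "'g \<Rightarrow> ('x \<Rightarrow>\<^sub>L 'x)"
    and R' :: "'g \<Rightarrow> ('y \<Rightarrow>\<^sub>L 'y)"
    and c\<^sub>1 c\<^sub>2 :: real
  assumes "locally_compact_space (euclidean :: 'g topology)"
    and "haar_measure \<mu>"
    and "K \<in> Lp_space (completion \<mu>) 1"
    and "strongly_continuous_representation R"
    and "strongly_continuous_representation R'"
    and "\<And>u. norm (R u) \<le> c\<^sub>1"
    and "\<And>u. norm (R' u) \<le> c\<^sub>2"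
    and "\<And>u v x. blinfun_apply (K u) (blinfun_apply (R v) x)
                 = blinfun_apply (R' v) (blinfun_apply (K u) x)"
  shows "(\<forall>x. bochner_integrable (completion \<mu>)
                (\<lambda>u. blinfun_apply (K u) (blinfun_apply (R (- u)) x))) \<and>
         bounded_linear (transference_op \<mu> K R) \<and>
         ennreal (onorm (transference_op \<mu> K R))
           \<le> (INF p\<in>{1..}. ennreal (c\<^sub>1 * c\<^sub>2) * conv_op_norm \<mu> p K)"
proof -
  interpret transference \<mu> K R R' c\<^sub>1 c\<^sub>2
    by unfold_locales (fact assms)+
  show ?thesis
    using orbit_kernel_integrable bounded_linear_T onorm_T_le
    by (auto simp: orbit_kernel_def[abs_def] intro!: INF_greatest)
qed

end
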